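(* Let $d\ge1$, $\varrho\ge0$, $\gamma>-\tfrac12$, $\mu>-\tfrac12$. For every $n=0,1,2,\ldots$, every $u\in\mathcal V_n^E(\mathbb V^{d+1},W_{\frac12,\gamma,\mu})$ satisfies $$\Big[(1+\varrho^2-t^2)\Big(1-\frac{\varrho^2}{t^2}\Big)\partial_t^2+\Delta_x-\langle x,\nabla_x\rangle^2+\langle x,\nabla_x\rangle+\frac2t(1+\varrho^2-t^2)\langle x,\nabla_x\rangle\partial_t+\Big((1+\varrho^2-t^2)\frac{\varrho^2}{t^2}+2\mu+d\Big)\frac1t\partial_t$$ $$\qquad-(2\gamma+2\mu+d+1)\Big(\Big(1-\frac{\varrho^2}{t^2}\Big)t\partial_t+\langle x,\nabla_x\rangle\Big)\Big]u=-n(n+2\gamma+2\mu+d)u .$$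
   Context: $\mathbb V^{d+1}=\{(x,t)\in\mathbb R^d\times\mathbb R:\ \|x\|^2\le t^2-\varrho^2,\ \varrho\le|t|\le\sqrt{\varrho^2+1}\}$ is the finite solid double hyperboloid (solid double cone if $\varrho=0$), and $$W_{\frac12,\gamma,\mu}(x,t)=|t|\,(\varrho^2+1-t^2)^{\gamma-\frac12}(t^2-\varrho^2-\|x\|^2)^{\mu-\frac12}.$$ $\mathcal V_n^E(\mathbb V^{d+1},W)$ is the space of polynomials in $(x,t)$ of degree at most $n$ that are even in $t$ and orthogonal, with respect to $\langle f,g\rangle_W=\int_{\mathbb V^{d+1}}f\,g\,W\,dx\,dt$, to all polynomials of degree at most $n-1$. $\Delta_x,\nabla_x$ are the Laplacian and gradient in $x\in\mathbb R^d$; $\langle x,\nabla_x\rangle=\sum_ix_i\partial_{x_i}$, $\langle x,\nabla_x\rangle^2$ is its square as an operator; $\partial_t$ is the derivative in $t$ with $x$ fixed. The identity holds for $t\ne0$. *)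

theory Defs
  imports "HOL-Analysis.Analysis"
begin

text \<open>
  Points of \<open>\<real>\<^sup>d \<times> \<real>\<close> are pairs \<open>(x, t)\<close> of type \<open>(real ^ 'n) \<times> real\<close>, with \<open>d = CARD('n) \<ge> 1\<close>.
\<close>

definition monomials_upto :: "nat \<Rightarrow> (('n::finite \<Rightarrow> nat) \<times> nat) set" where
  "monomials_upto n = {(\<alpha>, k). (\<Sum>i\<in>UNIV. \<alpha> i) + k \<le> n}"

text \<open>The index set is finite, so the sum in the next definition is a genuine finite sum.\<close>

lemma finite_monomials_upto: "finite (monomials_upto n :: (('n::finite \<Rightarrow> nat) \<times> nat) set)"
proof (rule finite_subset)
  show "monomials_upto n \<subseteq> (UNIV \<rightarrow>\<^sub>E {..n} :: ('n \<Rightarrow> nat) set) \<times> {..n}"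
  proof
    fix p :: "('n \<Rightarrow> nat) \<times> nat"
    assume p: "p \<in> monomials_upto n"
    have "fst p j \<le> (\<Sum>i\<in>UNIV. fst p i)" for j
      by (rule member_le_sum) auto
    moreover have "(\<Sum>i\<in>UNIV. fst p i) \<le> n" "snd p \<le> n"
      using p by (auto simp: monomials_upto_def split: prod.splits)
    ultimately have "fst p j \<le> n" for j
      using order_trans by blast
    with \<open>snd p \<le> n\<close> show "p \<in> (UNIV \<rightarrow>\<^sub>E {..n}) \<times> {..n}"
      by (simp add: mem_Times_iff PiE_iff)
  qed
  show "finite ((UNIV \<rightarrow>\<^sub>E {..n} :: ('n \<Rightarrow> nat) set) \<times> {..n})"
    by (intro finite_cartesian_product finite_PiE) auto
qed

text \<open>Real polynomials in \<open>(x, t)\<close> of total degree at most \<open>n\<close>, as functions on the whole space.\<close>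

definition polys_upto :: "nat \<Rightarrow> ((real ^ 'n::finite) \<times> real \<Rightarrow> real) set" where
  "polys_upto n = {f. \<exists>c :: ('n \<Rightarrow> nat) \<times> nat \<Rightarrow> real. \<forall>x t.
     f (x, t) = (\<Sum>(\<alpha>, k)\<in>monomials_upto n. c (\<alpha>, k) * (\<Prod>i\<in>UNIV. x $ i ^ \<alpha> i) * t ^ k)}"

definition double_hyperboloid :: "real \<Rightarrow> ((real ^ 'n::finite) \<times> real) set" where
  "double_hyperboloid \<rho> =
     {(x, t). (norm x)\<^sup>2 \<le> t\<^sup>2 - \<rho>\<^sup>2 \<and> \<rho> \<le> \<bar>t\<bar> \<and> \<bar>t\<bar> \<le> sqrt (\<rho>\<^sup>2 + 1)}"

text \<open>
  The weight \<open>W\<close> with parameters \<open>1/2, \<gamma>, \<mu>\<close>.  Both bases of \<open>powr\<close> are nonnegative on the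
  hyperboloid; they vanish only on its boundary, a null set, so the convention
  \<open>0 powr a = 0\<close> does not affect the inner product.
\<close>

definition hyp_weight :: "real \<Rightarrow> real \<Rightarrow> real \<Rightarrow> (real ^ 'n::finite) \<times> real \<Rightarrow> real" where
  "hyp_weight \<rho> \<gamma> \<mu> = (\<lambda>(x, t).
     \<bar>t\<bar> * (\<rho>\<^sup>2 + 1 - t\<^sup>2) powr (\<gamma> - 1/2) * (t\<^sup>2 - \<rho>\<^sup>2 - (norm x)\<^sup>2) powr (\<mu> - 1/2))"

definition hyp_inner :: "real \<Rightarrow> real \<Rightarrow> real \<Rightarrow>
    ((real ^ 'n::finite) \<times> real \<Rightarrow> real) \<Rightarrow> ((real ^ 'n) \<times> real \<Rightarrow> real) \<Rightarrow> real" where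
  "hyp_inner \<rho> \<gamma> \<mu> f g =
     (LINT z:double_hyperboloid \<rho>|lborel. f z * g z * hyp_weight \<rho> \<gamma> \<mu> z)"

text \<open>
  Orthogonality to all polynomials of degree at most \<open>n - 1\<close> is phrased with \<open>m < n\<close>, so that
  it is no condition at all for \<open>n = 0\<close>.
\<close>

definition orth_polys_even :: "real \<Rightarrow> real \<Rightarrow> real \<Rightarrow> nat \<Rightarrow> ((real ^ 'n::finite) \<times> real \<Rightarrow> real) set" where
  "orth_polys_even \<rho> \<gamma> \<mu> n = {f \<in> polys_upto n.
     (\<forall>x t. f (x, - t) = f (x, t)) \<and>
     (\<forall>m<n. \<forall>g\<in>polys_upto m. hyp_inner \<rho> \<gamma> \<mu> f g = 0)}"

definition partial_x :: "'n \<Rightarrow> ((real ^ 'n::finite) \<times> real \<Rightarrow> real) \<Rightarrow> (real ^ 'n) \<times> real \<Rightarrow> real" where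
  "partial_x i f = (\<lambda>(x, t). deriv (\<lambda>s. f (x + s *\<^sub>R axis i 1, t)) 0)"

definition partial_t :: "((real ^ 'n::finite) \<times> real \<Rightarrow> real) \<Rightarrow> (real ^ 'n) \<times> real \<Rightarrow> real" where
  "partial_t f = (\<lambda>(x, t). deriv (\<lambda>s. f (x, s)) t)"

definition laplace_x :: "((real ^ 'n::finite) \<times> real \<Rightarrow> real) \<Rightarrow> (real ^ 'n) \<times> real \<Rightarrow> real" where
  "laplace_x f z = (\<Sum>i\<in>UNIV. partial_x i (partial_x i f) z)"

text \<open>The Euler operator \<open>\<langle>x, \<nabla>\<^sub>x\<rangle>\<close>.\<close>

definition euler_x :: "((real ^ 'n::finite) \<times> real \<Rightarrow> real) \<Rightarrow> (real ^ 'n) \<times> real \<Rightarrow> real" where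
  "euler_x f z = (\<Sum>i\<in>UNIV. fst z $ i * partial_x i f z)"

end

theory Submission
  imports Defs
begin

text \<open>
  With \<open>r = t\<^sup>2 - \<rho>\<^sup>2\<close>, even polynomials are spanned by the monomials \<open>x\<^sup>\<alpha> r\<^sup>k\<close>, of degree
  \<open>\<bar>\<alpha>\<bar> + 2k\<close>, and the differential operator \<open>L\<close> has polynomial coefficients in \<open>(x, r)\<close>.  On such a
  monomial of degree \<open>N\<close> it acts as multiplication by \<open>-\<lambda>\<^sub>N\<close>, where \<open>\<lambda>\<^sub>N = N (N + 2\<gamma> + 2\<mu> + d)\<close>, plus
  terms of degree \<open>N - 2\<close>.  Integrating \<open>\<partial>\<^sub>i\<close> and \<open>\<partial>\<^sub>r\<close> of functions vanishing on the boundary gives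
  recurrences for the moments of the weight, and these show that \<open>L\<close> is symmetric on
  monomials.  Hence for \<open>u\<close> orthogonal to lower degrees, \<open>w = L u + \<lambda>\<^sub>n u\<close> has degree below \<open>n\<close> and
  \<open>\<langle>w, w\<rangle> = \<langle>u, (L + \<lambda>\<^sub>n) w\<rangle> = 0\<close>, so \<open>w\<close> vanishes.
\<close>

subsection \<open>Integrating directional derivatives\<close>

text \<open>The factor |t| in the weight is what makes r the natural variable: |t| dt is dr/2, so on
  even functions the inner product is, up to a constant, integration over |x|^2 <= r <= 1 against (1
  - r)^p (r - |x|^2)^q with p = \<gamma> - 1/2 and q = \<mu> - 1/2, and \<rho> disappears from the
  coefficients of all moment recurrences. The obstacle is the boundary: p and q are only known to
  exceed -1, so the weight may be unbounded there. Hence the weight is extended by zero, the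
  functions to be differentiated have the affected exponents raised by one, and they are studied
  only along lines. Symmetry of L is then an algebraic identity: <L f, g> - <f, L g> for monomials
  involves three kinds of moments, and after multiplication by one common factor the recurrences
  turn all of them into multiples of a single moment. This uses first derivatives only and no
  divergence form of L.\<close>

text \<open>Averaging over the translations by s v with s in [0,1] leaves the integral of
  \<open>g\<close> unchanged, while along each line the average is G(z + v) - G(z), whose integral
  vanishes by translation invariance. The finite exceptional sets admit the singularities of
  truncated powers at the boundary.\<close>

lemma integral_directional_derivative_eq_0:
  fixes G g :: "'a::euclidean_space \<Rightarrow> real" and v :: 'a
  assumes G: "integrable lborel G" and g: "integrable lborel g"
    and cont: "\<And>z. continuous_on UNIV (\<lambda>s. G (z + s *\<^sub>R v))"
    and deriv: "\<And>z. \<exists>S. finite S \<and>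
      (\<forall>s. s \<notin> S \<longrightarrow> ((\<lambda>s. G (z + s *\<^sub>R v)) has_real_derivative g (z + s *\<^sub>R v)) (at s))"
  shows "(LINT z|lborel. g z) = 0"
proof -
  have translate: "integrable lborel (\<lambda>z. f (z + c))" "(LINT z|lborel. f (z + c)) = (LINT z|lborel. f z)"
    if "integrable lborel f" for f :: "'a \<Rightarrow> real" and c
  proof -
    have [measurable]: "f \<in> borel_measurable borel"
      using that by simp
    have "integrable (distr lborel borel ((+) c)) f"
      using that by (simp add: lborel_distr_plus)
    then show "integrable lborel (\<lambda>z. f (z + c))"
      by (subst (asm) integrable_distr_eq) (auto simp: add.commute)
    have "(LINT z|distr lborel borel ((+) c). f z) = (LINT z|lborel. f (c + z))"
      by (intro integral_distr) auto
    then show "(LINT z|lborel. f (z + c)) = (LINT z|lborel. f z)"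
      by (simp add: lborel_distr_plus add.commute)
  qed
  define F :: "real \<Rightarrow> 'a \<Rightarrow> real" where "F s z = indicator {0..1} s * g (z + s *\<^sub>R v)" for s z
  have [measurable]: "g \<in> borel_measurable borel"
    using g by simp
  have Fint: "integrable lborel (F s)" for s
    unfolding F_def using translate(1)[OF g] by auto
  have Fabs: "(LINT z|lborel. norm (F s z)) = indicator {0..1} s * (LINT z|lborel. norm (g z))" for s
  proof -
    have "norm (F s z) = indicator {0..1} s * norm (g (z + s *\<^sub>R v))" for z
      by (simp add: F_def abs_mult)
    then show ?thesis
      using translate(2)[OF integrable_norm[OF g], of "s *\<^sub>R v"] by simp
  qed
  have int1: "integrable lborel (\<lambda>s. LINT z|lborel. norm (F s z))"
    unfolding Fabs by (intro integrable_mult_left integrable_real_indicator) auto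
  have Fpair: "integrable (lborel \<Otimes>\<^sub>M lborel) (case_prod F)"
  proof (rule lborel_pair.Fubini_integrable)
    have "(\<lambda>p. indicator {0..1} (fst p) * g (snd p + fst p *\<^sub>R v)) \<in> borel_measurable (lborel \<Otimes>\<^sub>M lborel)"
      by measurable
    then show "case_prod F \<in> borel_measurable (lborel \<Otimes>\<^sub>M lborel)"
      by (simp only: F_def case_prod_beta')
  qed (use int1 Fint in auto)
  have swap: "(LINT z|lborel. LINT s|lborel. F s z) = (LINT s|lborel. LINT z|lborel. F s z)"
    using Fpair by (rule lborel_pair.Fubini_integral)
  have "(LINT s|lborel. LINT z|lborel. F s z) = (LINT s|lborel. indicator {0..1::real} s * (LINT z|lborel. g z))"
    unfolding F_def integral_mult_right_zero translate(2)[OF g] ..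
  also have "\<dots> = (LINT s|lborel. indicator {0..1::real} s) * (LINT z|lborel. g z)"
    by (rule integral_mult_left_zero)
  also have "\<dots> = (LINT z|lborel. g z)"
    by simp
  finally have lhs: "(LINT z|lborel. LINT s|lborel. F s z) = (LINT z|lborel. g z)"
    using swap by simp
  \<comment> \<open>Fubini gives integrability along almost every line; there the Lebesgue integral
    agrees with the gauge integral that the fundamental theorem of calculus evaluates.\<close>
  have "AE z in lborel. integrable lborel (\<lambda>s. F s z)"
    using Fpair by (rule lborel_pair.AE_integrable_snd)
  then have "AE z in lborel. (LINT s|lborel. F s z) = G (z + v) - G z"
  proof eventually_elim
    case (elim z)
    have "((\<lambda>s. F s z) has_integral (LINT s|lborel. F s z)) UNIV"
      using elim by (rule has_integral_integral_lborel)
    moreover have "(\<lambda>s. F s z) = (\<lambda>s. if s \<in> {0..1} then g (z + s *\<^sub>R v) else 0)"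
      by (auto simp: F_def)
    ultimately have 1: "((\<lambda>s. g (z + s *\<^sub>R v)) has_integral (LINT s|lborel. F s z)) {0..1}"
      using has_integral_restrict_UNIV by metis
    obtain S where S: "finite S"
      "\<And>s. s \<notin> S \<Longrightarrow> ((\<lambda>s. G (z + s *\<^sub>R v)) has_real_derivative g (z + s *\<^sub>R v)) (at s)"
      using deriv by blast
    have 2: "((\<lambda>s. g (z + s *\<^sub>R v)) has_integral (G (z + 1 *\<^sub>R v) - G (z + 0 *\<^sub>R v))) {0..1}"
      by (rule fundamental_theorem_of_calculus_interior_strong[OF S(1)])
         (auto intro!: continuous_on_subset[OF cont] S(2) has_real_derivative_iff_has_vector_derivative[THEN iffD1])
    show ?case
      using has_integral_unique[OF 1 2] by simp
  qed
  then have "(LINT z|lborel. LINT s|lborel. F s z) = (LINT z|lborel. G (z + v) - G z)"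
    using Fpair G lborel_pair.integrable_snd[OF Fpair]
    by (intro integral_cong_AE) auto
  also have "\<dots> = 0"
    using translate[OF G, of v] G by simp
  finally show ?thesis
    using lhs by simp
qed

section \<open>Truncated powers\<close>

text \<open>The truncated power of the positive part of y. Since \<open>0 powr p = 0\<close> for
  every p, it vanishes for y <= 0 even when p <= 0, so integrals over the hyperboloid can be taken
  over the whole space.\<close>

definition pospow :: "real \<Rightarrow> real \<Rightarrow> real" where
  "pospow p y = max 0 y powr p"

lemma pospow_nonneg [simp]: "0 \<le> pospow p y"
  by (simp add: pospow_def)

lemma pospow_eq_0 [simp]: "y \<le> 0 \<Longrightarrow> pospow p y = 0"
  by (simp add: pospow_def)

lemma pospow_pos: "0 < y \<Longrightarrow> pospow p y = y powr p"
  by (simp add: pospow_def)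

lemma pospow_add_1: "pospow (p + 1) y = y * pospow p y"
  by (cases "y > 0") (simp_all add: pospow_pos powr_add)

lemma borel_measurable_pospow [measurable]: "pospow p \<in> borel_measurable borel"
  unfolding pospow_def by measurable

lemma continuous_on_pospow [continuous_intros]:
  assumes "0 < p" "continuous_on S f"
  shows "continuous_on S (\<lambda>x. pospow p (f x))"
  unfolding pospow_def using assms by (intro continuous_on_powr') (auto intro: continuous_on_max)

lemma DERIV_pospow:
  assumes "y \<noteq> 0"
  shows "(pospow p has_real_derivative p * pospow (p - 1) y) (at y)"
proof (cases "y > 0")
  case True
  have "((\<lambda>y. y powr p) has_real_derivative p * y powr (p - 1)) (at y)"
    using True by (rule has_real_derivative_powr)
  then have "(pospow p has_real_derivative p * y powr (p - 1)) (at y)"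
    by (rule has_field_derivative_transform_within_open[where S="{0<..}"])
       (use True in \<open>auto simp: pospow_pos\<close>)
  then show ?thesis
    using True by (simp add: pospow_pos)
next
  case False
  have "((\<lambda>_. 0) has_real_derivative 0) (at y)"
    by simp
  then have "(pospow p has_real_derivative 0) (at y)"
    by (rule has_field_derivative_transform_within_open[where S="{..<0}"])
       (use False assms in auto)
  then show ?thesis
    using False by simp
qed

section \<open>Integrability of the weight\<close>

lemma nn_integral_scaleR:
  fixes f :: "'a::euclidean_space \<Rightarrow> ennreal"
  assumes [measurable]: "f \<in> borel_measurable borel" and c: "c \<noteq> 0"
  shows "(\<integral>\<^sup>+x. f x \<partial>lborel) = ennreal (\<bar>c\<bar> ^ DIM('a)) * (\<integral>\<^sup>+x. f (c *\<^sub>R x) \<partial>lborel)"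
  by (subst lborel_affine[OF c, of 0])
     (simp add: nn_integral_density nn_integral_distr nn_integral_cmult)

lemma nn_integral_pospow_Beta:
  assumes "-1 < p" "-1 < q"
  shows "(\<integral>\<^sup>+s. ennreal (pospow p (1 - s) * pospow q s) \<partial>lborel) < \<infinity>"
proof -
  have "set_integrable lborel {0..1} (\<lambda>t. t powr ((q + 1) - 1) * (1 - t) powr ((p + 1) - 1))"
    using assms by (intro integrable_Beta) auto
  then have "integrable lborel (\<lambda>t. indicator {0..1} t * (t powr q * (1 - t) powr p))"
    by (simp add: set_integrable_def)
  also have "(\<lambda>t::real. indicator {0..1} t * (t powr q * (1 - t) powr p)) =
      (\<lambda>s. pospow p (1 - s) * pospow q s)"
    by (auto simp: fun_eq_iff indicator_def pospow_def max_def)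
  finally have "integrable lborel (\<lambda>s. pospow p (1 - s) * pospow q s)" .
  then show ?thesis
    by (simp add: integrable_iff_bounded)
qed

lemma powr_le_powr_abs:
  fixes y p :: real
  assumes "1 / 2 \<le> y" "y \<le> 2"
  shows "y powr p \<le> 2 powr \<bar>p\<bar>"
proof -
  have l: "\<bar>ln y\<bar> \<le> ln 2"
  proof -
    have "ln (1/2) \<le> ln y" "ln y \<le> ln 2"
      using assms by (subst ln_le_cancel_iff; simp)+
    then show ?thesis by (simp add: ln_div)
  qed
  have "p * ln y \<le> \<bar>p\<bar> * \<bar>ln y\<bar>"
    using abs_ge_self[of "p * ln y"] by (simp add: abs_mult)
  also have "\<dots> \<le> \<bar>p\<bar> * ln 2"
    using l by (intro mult_left_mono) auto
  finally show ?thesis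
    using assms by (simp add: powr_def)
qed

text \<open>Averaging over the dilations by \<open>l \<in> {1..2}\<close> reduces the singularity at the unit sphere to
  a one-dimensional integral along each ray.\<close>

lemma nn_integral_pospow_shell:
  assumes q: "-1 < q"
  shows "(\<integral>\<^sup>+(x::'a::euclidean_space). ennreal (indicator {1/2<..} (norm x) * pospow q (1 - norm x)) \<partial>lborel) < \<infinity>"
proof -
  define \<phi> :: "real \<Rightarrow> real" where "\<phi> s = indicator {1/2<..} s * pospow q (1 - s)" for s
  define K where "K = (\<integral>\<^sup>+s. ennreal (\<phi> s) \<partial>lborel)"
  have [measurable]: "\<phi> \<in> borel_measurable borel"
    unfolding \<phi>_def by measurable
  have "K \<le> (\<integral>\<^sup>+s. ennreal (pospow q (1 - s) * pospow 0 s) \<partial>lborel)"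
    unfolding K_def by (intro nn_integral_mono ennreal_leI) (auto simp: \<phi>_def pospow_def indicator_def)
  also have "\<dots> < \<infinity>"
    using q by (intro nn_integral_pospow_Beta) auto
  finally have K: "K < \<infinity>" .
  define I where "I = (\<integral>\<^sup>+(x::'a). ennreal (\<phi> (norm x)) \<partial>lborel)"
  \<comment> \<open>The interval of dilations has length one, so averaging the constant
    \<open>I\<close> over it returns \<open>I\<close>.\<close>
  have "I = (\<integral>\<^sup>+l. indicator {1..2::real} l * I \<partial>lborel)"
    by (simp add: nn_integral_multc)
  also have "\<dots> \<le> (\<integral>\<^sup>+l. (\<integral>\<^sup>+(x::'a). 2 ^ DIM('a) * (indicator {1..2::real} l * ennreal (\<phi> (norm (l *\<^sub>R x)))) \<partial>lborel) \<partial>lborel)"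
  proof (rule nn_integral_mono)
    fix l :: real
    show "indicator {1..2} l * I \<le> (\<integral>\<^sup>+(x::'a). 2 ^ DIM('a) * (indicator {1..2::real} l * ennreal (\<phi> (norm (l *\<^sub>R x)))) \<partial>lborel)"
    proof (cases "l \<in> {1..2}")
      case True
      have "I = ennreal (\<bar>l\<bar> ^ DIM('a)) * (\<integral>\<^sup>+(x::'a). ennreal (\<phi> (norm (l *\<^sub>R x))) \<partial>lborel)"
        unfolding I_def using True by (subst nn_integral_scaleR[where c=l]) (auto simp: ennreal_power)
      also have "\<dots> \<le> 2 ^ DIM('a) * (\<integral>\<^sup>+(x::'a). ennreal (\<phi> (norm (l *\<^sub>R x))) \<partial>lborel)"
        using True by (intro mult_right_mono) (auto simp flip: ennreal_numeral ennreal_power intro!: ennreal_leI power_mono)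
      finally show ?thesis
        using True by (subst nn_integral_cmult) auto
    qed simp
  qed
  also have "\<dots> = (\<integral>\<^sup>+(x::'a). (\<integral>\<^sup>+l. 2 ^ DIM('a) * (indicator {1..2::real} l * ennreal (\<phi> (norm (l *\<^sub>R x)))) \<partial>lborel) \<partial>lborel)"
    by (rule lborel_pair.Fubini') measurable
  also have "\<dots> \<le> (\<integral>\<^sup>+(x::'a). 2 ^ DIM('a) * (4 * K) * indicator (ball 0 1) x \<partial>lborel)"
  proof (rule nn_integral_mono)
    fix x :: 'a
    have eq: "indicator {1..2::real} l * ennreal (\<phi> (norm (l *\<^sub>R x))) =
        indicator {1..2::real} l * ennreal (\<phi> (l * norm x))" for l
      by (auto simp: indicator_def)
    \<comment> \<open>The integrand is nonzero only for l |x| in (1/2, 1), which for l in [1,2]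
      forces 1/4 < |x| < 1. The substitution of l |x| for l then costs the factor 1/|x| < 4.\<close>
    have "(\<integral>\<^sup>+l. indicator {1..2::real} l * ennreal (\<phi> (l * norm x)) \<partial>lborel) \<le> (4 * K) * indicator (ball 0 1) x"
    proof (cases "1/4 < norm x \<and> norm x < 1")
      case True
      then have n: "norm x > 0" by linarith
      have "K = ennreal (norm x) * (\<integral>\<^sup>+l. ennreal (\<phi> (l * norm x)) \<partial>lborel)"
        unfolding K_def using n
        by (subst nn_integral_real_affine[where c="norm x" and t=0]) (auto simp: mult.commute)
      then have "(\<integral>\<^sup>+l. ennreal (\<phi> (l * norm x)) \<partial>lborel) = ennreal (1 / norm x) * K"
        using n by (simp add: mult.assoc[symmetric] ennreal_mult[symmetric])
      also have "\<dots> \<le> 4 * K"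
        using True by (intro mult_right_mono) (auto simp: divide_simps simp flip: ennreal_numeral intro!: ennreal_leI)
      finally have "(\<integral>\<^sup>+l. ennreal (\<phi> (l * norm x)) \<partial>lborel) \<le> 4 * K" .
      moreover have "(\<integral>\<^sup>+l. indicator {1..2::real} l * ennreal (\<phi> (l * norm x)) \<partial>lborel) \<le> (\<integral>\<^sup>+l. ennreal (\<phi> (l * norm x)) \<partial>lborel)"
        by (intro nn_integral_mono) (auto simp: indicator_def)
      ultimately show ?thesis
        using True by simp
    next
      case False
      have "\<phi> (l * norm x) = 0" if "l \<in> {1..2}" for l
      proof (cases "norm x < 1")
        case True
        with False have "norm x \<le> 1/4" by auto
        then have "l * norm x \<le> 2 * (1/4)"
          using that by (intro mult_mono) auto
        then show ?thesis by (simp add: \<phi>_def)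
      next
        case False
        then have "1 * 1 \<le> l * norm x"
          using that by (intro mult_mono) auto
        then show ?thesis by (simp add: \<phi>_def)
      qed
      then have "indicator {1..2::real} l * ennreal (\<phi> (l * norm x)) = 0" for l
        by (auto simp: indicator_def)
      then show ?thesis by (simp only: nn_integral_const) simp
    qed
    then show "(\<integral>\<^sup>+l. 2 ^ DIM('a) * (indicator {1..2::real} l * ennreal (\<phi> (norm (l *\<^sub>R x)))) \<partial>lborel) \<le> 2 ^ DIM('a) * (4 * K) * indicator (ball 0 1) x"
      unfolding eq by (subst nn_integral_cmult) (auto simp: mult.assoc intro!: mult_left_mono)
  qed
  also have "\<dots> = 2 ^ DIM('a) * (4 * K) * emeasure lborel (ball (0::'a) 1)"
    by (intro nn_integral_cmult_indicator) auto
  also have "\<dots> < \<infinity>"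
    using K emeasure_lborel_ball_finite[of "0::'a" 1] by (auto simp: ennreal_mult_less_top power_less_top_ennreal)
  finally show ?thesis
    by (simp add: I_def \<phi>_def)
qed

text \<open>In 1 - |x|^2 = (1 + |x|)(1 - |x|) the first factor lies in [1,2], so only 1 - |x| can be
  singular. For |x| <= 1/2 both powers are bounded by \<open>C\<close>; the remaining region is the
  shell already treated.\<close>

lemma nn_integral_pospow_ball:
  assumes q: "-1 < q"
  shows "(\<integral>\<^sup>+(x::'a::euclidean_space). ennreal (pospow q (1 - (norm x)\<^sup>2)) \<partial>lborel) < \<infinity>"
proof -
  define C where "C = 2 powr \<bar>q\<bar>"
  have C: "0 \<le> C" by (simp add: C_def)
  have "pospow q (1 - (norm x)\<^sup>2) \<le>
      C * C * indicator (ball 0 1) x + C * (indicator {1/2<..} (norm x) * pospow q (1 - norm x))"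
    for x :: 'a
  proof (cases "norm x < 1")
    case True
    have "pospow q (1 - (norm x)\<^sup>2) = (1 + norm x) powr q * pospow q (1 - norm x)"
    proof -
      have "1 - (norm x)\<^sup>2 = (1 + norm x) * (1 - norm x)"
        by (simp add: power2_eq_square algebra_simps)
      moreover have "0 < (1 + norm x) * (1 - norm x)"
        using True by (intro mult_pos_pos) (auto simp: add_pos_nonneg)
      ultimately show ?thesis
        using True by (simp add: pospow_pos powr_mult)
    qed
    also have "\<dots> \<le> C * pospow q (1 - norm x)"
      unfolding C_def using True by (intro mult_right_mono powr_le_powr_abs) auto
    also have "\<dots> \<le> C * C * indicator (ball 0 1) x + C * (indicator {1/2<..} (norm x) * pospow q (1 - norm x))"
    proof (cases "norm x > 1/2")
      case False
      then have "pospow q (1 - norm x) \<le> C"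
        unfolding C_def using True norm_ge_zero[of x] by (subst pospow_pos) (auto intro!: powr_le_powr_abs simp del: norm_ge_zero)
      then have "C * pospow q (1 - norm x) \<le> C * C"
        using C by (intro mult_left_mono)
      then show ?thesis
        using True False by simp
    qed (use C True in simp)
    finally show ?thesis .
  next
    case False
    then have "1 \<le> (norm x)\<^sup>2"
      by (simp add: one_le_power)
    then show ?thesis
      using C by simp
  qed
  then have "(\<integral>\<^sup>+(x::'a). ennreal (pospow q (1 - (norm x)\<^sup>2)) \<partial>lborel) \<le>
      (\<integral>\<^sup>+(x::'a). ennreal (C * C) * indicator (ball 0 1) x
        + ennreal C * ennreal (indicator {1/2<..} (norm x) * pospow q (1 - norm x)) \<partial>lborel)"
    using C by (intro nn_integral_mono) (auto simp: ennreal_mult[symmetric] ennreal_indicator[symmetric] ennreal_plus[symmetric] simp del: ennreal_plus intro!: ennreal_leI)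
  also have "\<dots> = ennreal (C * C) * emeasure lborel (ball (0::'a) 1)
      + ennreal C * (\<integral>\<^sup>+(x::'a). ennreal (indicator {1/2<..} (norm x) * pospow q (1 - norm x)) \<partial>lborel)"
  proof (subst nn_integral_add)
    show "(\<lambda>x::'a. ennreal (C * C) * indicator (ball 0 1) x) \<in> borel_measurable lborel"
      by (intro borel_measurable_times_ennreal borel_measurable_const borel_measurable_indicator) auto
  qed (auto simp: nn_integral_cmult nn_integral_cmult_indicator)
  also have "\<dots> < \<infinity>"
    using nn_integral_pospow_shell[OF q, where 'a='a] emeasure_lborel_ball_finite[of "0::'a" 1]
    by (auto simp: ennreal_mult_less_top)
  finally show ?thesis .
qed

text \<open>Scaling x by sqrt c produces c^q from the integrand and c^(d/2) from the volume element;
  for c <= 0 both sides vanish.\<close>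

lemma nn_integral_pospow_ball_scaled:
  "(\<integral>\<^sup>+(x::'a::euclidean_space). ennreal (pospow q (c - (norm x)\<^sup>2)) \<partial>lborel) =
    ennreal (pospow (q + DIM('a) / 2) c) * (\<integral>\<^sup>+(x::'a). ennreal (pospow q (1 - (norm x)\<^sup>2)) \<partial>lborel)"
proof (cases "c > 0")
  case True
  have *: "pospow q (c - (norm (sqrt c *\<^sub>R x))\<^sup>2) = c powr q * pospow q (1 - (norm x)\<^sup>2)" for x :: 'a
  proof -
    have "c - (norm (sqrt c *\<^sub>R x))\<^sup>2 = c * (1 - (norm x)\<^sup>2)"
      using True by (simp add: power_mult_distrib algebra_simps)
    moreover have "max 0 (c * (1 - (norm x)\<^sup>2)) = c * max 0 (1 - (norm x)\<^sup>2)"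
      using True by (simp add: max_def zero_le_mult_iff)
    ultimately show ?thesis
      using True by (simp add: pospow_def powr_mult)
  qed
  have "(\<integral>\<^sup>+(x::'a). ennreal (pospow q (c - (norm x)\<^sup>2)) \<partial>lborel) =
      ennreal (\<bar>sqrt c\<bar> ^ DIM('a)) * (\<integral>\<^sup>+(x::'a). ennreal (c powr q) * ennreal (pospow q (1 - (norm x)\<^sup>2)) \<partial>lborel)"
    using True by (subst nn_integral_scaleR[where c="sqrt c"]) (simp_all only: * ennreal_mult pospow_nonneg powr_ge_zero ennreal_power abs_ge_zero, auto)
  also have "\<dots> = ennreal (\<bar>sqrt c\<bar> ^ DIM('a) * c powr q) * (\<integral>\<^sup>+(x::'a). ennreal (pospow q (1 - (norm x)\<^sup>2)) \<partial>lborel)"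
    by (subst nn_integral_cmult) (auto simp: ennreal_mult mult.assoc)
  also have "\<bar>sqrt c\<bar> ^ DIM('a) * c powr q = pospow (q + DIM('a) / 2) c"
    using True by (simp add: pospow_pos powr_add powr_half_sqrt[symmetric] powr_realpow[symmetric] powr_powr mult.commute)
  finally show ?thesis .
next
  case False
  have "c - (norm x)\<^sup>2 \<le> 0" for x :: 'a
    using False zero_le_power2[of "norm x"] by linarith
  then show ?thesis
    using False by simp
qed

text \<open>On t >= 0 this is the substitution s = t^2 - \<rho>^2 with ds = 2 t dt, and negative t
  are reflected. The support of \<open>h\<close> confines t to |t| <= sqrt(1 + \<rho>^2), so a
  substitution on a compact interval suffices.\<close>

lemma nn_integral_even_quadratic_substitution:
  fixes h :: "real \<Rightarrow> real"
  assumes [measurable]: "h \<in> borel_measurable borel" and nonneg: "\<And>s. 0 \<le> h s"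
    and supp: "\<And>s. 1 < s \<Longrightarrow> h s = 0"
    and fin: "(\<integral>\<^sup>+s. ennreal (h s) \<partial>lborel) < \<infinity>"
  shows "(\<integral>\<^sup>+t. ennreal (\<bar>t\<bar> * h (t\<^sup>2 - \<rho>\<^sup>2)) \<partial>lborel) < \<infinity>"
proof -
  define M where "M = sqrt (1 + \<rho>\<^sup>2)"
  have M: "0 \<le> M" "M\<^sup>2 = 1 + \<rho>\<^sup>2" by (auto simp: M_def)
  define k where "k t = h (t\<^sup>2 - \<rho>\<^sup>2) * (2 * t) * indicator {0..M} t" for t
  have [measurable]: "k \<in> borel_measurable borel"
    unfolding k_def by measurable
  have knn: "0 \<le> k t" for t
    using nonneg by (auto simp: k_def indicator_def)
  have "(\<integral>\<^sup>+t. ennreal (k t) \<partial>lborel) = (\<integral>\<^sup>+s. ennreal (h s * indicator {0\<^sup>2 - \<rho>\<^sup>2..M\<^sup>2 - \<rho>\<^sup>2} s) \<partial>lborel)"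
    unfolding k_def
    by (rule nn_integral_substitution[symmetric])
       (use M in \<open>auto simp: set_borel_measurable_def intro!: derivative_eq_intros continuous_intros\<close>)
  also have "\<dots> \<le> (\<integral>\<^sup>+s. ennreal (h s) \<partial>lborel)"
    using nonneg by (intro nn_integral_mono ennreal_leI) (auto simp: indicator_def)
  finally have kfin: "(\<integral>\<^sup>+t. ennreal (k t) \<partial>lborel) < \<infinity>"
    using fin by auto
  have kneg: "(\<integral>\<^sup>+t. ennreal (k (- t)) \<partial>lborel) = (\<integral>\<^sup>+t. ennreal (k t) \<partial>lborel)"
    by (subst (2) nn_integral_real_affine[where c="-1" and t=0]) auto
  have "\<bar>t\<bar> * h (t\<^sup>2 - \<rho>\<^sup>2) \<le> k t + k (- t)" for t
  proof (cases "\<bar>t\<bar> \<le> M")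
    case True
    then show ?thesis
      using nonneg[of "t\<^sup>2 - \<rho>\<^sup>2"] by (cases "t \<ge> 0") (auto simp: k_def indicator_def abs_le_iff mult_nonpos_nonneg)
  next
    case False
    then have "M\<^sup>2 < \<bar>t\<bar>\<^sup>2"
      using M(1) by (intro power_strict_mono) auto
    then show ?thesis
      using M supp[of "t\<^sup>2 - \<rho>\<^sup>2"] knn by simp
  qed
  then have "(\<integral>\<^sup>+t. ennreal (\<bar>t\<bar> * h (t\<^sup>2 - \<rho>\<^sup>2)) \<partial>lborel) \<le> (\<integral>\<^sup>+t. ennreal (k t) + ennreal (k (- t)) \<partial>lborel)"
    using knn by (intro nn_integral_mono) (auto simp flip: ennreal_plus intro!: ennreal_leI)
  also have "\<dots> = (\<integral>\<^sup>+t. ennreal (k t) \<partial>lborel) + (\<integral>\<^sup>+t. ennreal (k (- t)) \<partial>lborel)"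
    by (intro nn_integral_add) auto
  also have "\<dots> < \<infinity>"
    using kfin kneg by auto
  finally show ?thesis .
qed

text \<open>The exponents p and q stand for \<gamma> - 1/2 and \<mu> - 1/2; truncating both powers
  replaces the indicator of the hyperboloid.\<close>

definition hwt :: "real \<Rightarrow> real \<Rightarrow> real \<Rightarrow> (real ^ 'n::finite) \<times> real \<Rightarrow> real" where
  "hwt \<rho> p q z = \<bar>snd z\<bar> * pospow p (\<rho>\<^sup>2 + 1 - (snd z)\<^sup>2) * pospow q ((snd z)\<^sup>2 - \<rho>\<^sup>2 - (norm (fst z))\<^sup>2)"

lemma hwt_nonneg [simp]: "0 \<le> hwt \<rho> p q z"
  by (simp add: hwt_def)

lemma borel_measurable_hwt [measurable]: "hwt \<rho> p q \<in> borel_measurable borel"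
  unfolding hwt_def borel_prod[symmetric] by measurable

text \<open>For fixed t the slice in x is a ball of squared radius r = t^2 - \<rho>^2, which
  contributes r^(q + d/2) by scaling. Substituting r for t leaves a Beta integral with exponents p
  and q + d/2.\<close>

lemma integrable_hwt:
  assumes p: "-1 < p" and q: "-1 < q"
  shows "integrable lborel (hwt \<rho> p q :: (real ^ 'n::finite) \<times> real \<Rightarrow> real)"
proof -
  define K where "K = (\<integral>\<^sup>+(x::real^'n). ennreal (pospow q (1 - (norm x)\<^sup>2)) \<partial>lborel)"
  have K: "K < \<infinity>"
    unfolding K_def using q by (rule nn_integral_pospow_ball)
  define h where "h s = pospow p (1 - s) * pospow (q + real CARD('n) / 2) s" for s
  have [measurable]: "h \<in> borel_measurable borel"
    unfolding h_def by measurable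
  have inner: "(\<integral>\<^sup>+(x::real^'n). ennreal (hwt \<rho> p q (x, t)) \<partial>lborel) = ennreal (\<bar>t\<bar> * h (t\<^sup>2 - \<rho>\<^sup>2)) * K" for t
  proof -
    have "(\<integral>\<^sup>+(x::real^'n). ennreal (hwt \<rho> p q (x, t)) \<partial>lborel) =
        (\<integral>\<^sup>+(x::real^'n). ennreal (\<bar>t\<bar> * pospow p (\<rho>\<^sup>2 + 1 - t\<^sup>2)) * ennreal (pospow q (t\<^sup>2 - \<rho>\<^sup>2 - (norm x)\<^sup>2)) \<partial>lborel)"
      by (simp add: hwt_def ennreal_mult)
    also have "\<dots> = ennreal (\<bar>t\<bar> * pospow p (\<rho>\<^sup>2 + 1 - t\<^sup>2)) * (ennreal (pospow (q + CARD('n) / 2) (t\<^sup>2 - \<rho>\<^sup>2)) * K)"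
    proof -
      have "(\<integral>\<^sup>+(x::real^'n). ennreal (pospow q (t\<^sup>2 - \<rho>\<^sup>2 - (norm x)\<^sup>2)) \<partial>lborel) =
          ennreal (pospow (q + real CARD('n) / 2) (t\<^sup>2 - \<rho>\<^sup>2)) * K"
        unfolding K_def by (subst nn_integral_pospow_ball_scaled) simp
      then show ?thesis
        by (subst nn_integral_cmult) auto
    qed
    also have "\<dots> = ennreal (\<bar>t\<bar> * h (t\<^sup>2 - \<rho>\<^sup>2)) * K"
    proof -
      have "1 - (t\<^sup>2 - \<rho>\<^sup>2) = \<rho>\<^sup>2 + 1 - t\<^sup>2" by simp
      then show ?thesis
        by (simp only: h_def ennreal_mult mult.assoc pospow_nonneg abs_ge_zero mult_nonneg_nonneg)
    qed
    finally show ?thesis .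
  qed
  have "(\<integral>\<^sup>+z. ennreal (hwt \<rho> p q z) \<partial>(lborel :: ((real^'n) \<times> real) measure)) =
      (\<integral>\<^sup>+t. (\<integral>\<^sup>+(x::real^'n). ennreal (hwt \<rho> p q (x, t)) \<partial>lborel) \<partial>lborel)"
    unfolding lborel_prod[symmetric] by (rule lborel_pair.nn_integral_snd[symmetric]) (simp add: lborel_prod)
  also have "\<dots> = (\<integral>\<^sup>+t. ennreal (\<bar>t\<bar> * h (t\<^sup>2 - \<rho>\<^sup>2)) \<partial>lborel) * K"
    unfolding inner by (intro nn_integral_multc) measurable
  also have "\<dots> < \<infinity>"
  proof -
    have "(\<integral>\<^sup>+s. ennreal (h s) \<partial>lborel) < \<infinity>"
      unfolding h_def
    proof (rule nn_integral_pospow_Beta[OF p])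
      show "- 1 < q + real CARD('n) / 2"
        using q by (rule less_le_trans) simp
    qed
    then have "(\<integral>\<^sup>+t. ennreal (\<bar>t\<bar> * h (t\<^sup>2 - \<rho>\<^sup>2)) \<partial>lborel) < \<infinity>"
      by (intro nn_integral_even_quadratic_substitution) (auto simp: h_def)
    with K show ?thesis
      by (simp add: ennreal_mult_less_top)
  qed
  finally show ?thesis
    by (simp add: integrable_iff_bounded)
qed

subsection \<open>The weight\<close>

definition hyp_integral :: "real \<Rightarrow> real \<Rightarrow> real \<Rightarrow> ((real ^ 'n::finite) \<times> real \<Rightarrow> real) \<Rightarrow> real" where
  "hyp_integral \<rho> p q f = (LINT z|lborel. f z * hwt \<rho> p q z)"

lemma mem_support_hwt:
  fixes z :: "(real ^ 'n::finite) \<times> real"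
  assumes a: "0 < (snd z)\<^sup>2 - \<rho>\<^sup>2 - (norm (fst z))\<^sup>2" and b: "0 < \<rho>\<^sup>2 + 1 - (snd z)\<^sup>2"
  shows "z \<in> cball 0 1 \<times> cball 0 (sqrt (\<rho>\<^sup>2 + 1))"
proof -
  have "(norm (fst z))\<^sup>2 \<le> 1\<^sup>2"
    using a b by simp
  then have "norm (fst z) \<le> 1"
    by (rule power2_le_imp_le) simp
  moreover have "\<bar>snd z\<bar> \<le> sqrt (\<rho>\<^sup>2 + 1)"
    using b by (intro real_le_rsqrt) auto
  ultimately show ?thesis
    by (simp add: mem_Times_iff)
qed

lemma real_polynomial_function_bounded_on_support:
  fixes f :: "(real ^ 'n::finite) \<times> real \<Rightarrow> real"
  assumes "real_polynomial_function f"
  obtains C where "0 \<le> C" "\<And>z. z \<in> cball 0 1 \<times> cball 0 (sqrt (\<rho>\<^sup>2 + 1)) \<Longrightarrow> \<bar>f z\<bar> \<le> C"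
proof -
  have "compact (f ` (cball 0 1 \<times> cball 0 (sqrt (\<rho>\<^sup>2 + 1))))"
    by (intro compact_continuous_image compact_Times compact_cball)
       (use assms in \<open>simp add: continuous_on_polymonial_function real_polynomial_function_eq\<close>)
  then obtain C where "\<forall>y \<in> f ` (cball 0 1 \<times> cball 0 (sqrt (\<rho>\<^sup>2 + 1))). norm y \<le> C"
    using compact_imp_bounded bounded_iff by metis
  then have "0 \<le> max C 0" "\<And>z. z \<in> cball 0 1 \<times> cball 0 (sqrt (\<rho>\<^sup>2 + 1)) \<Longrightarrow> \<bar>f z\<bar> \<le> max C 0"
    by (auto simp: le_max_iff_disj)
  then show thesis
    using that by blast
qed

lemma borel_measurable_real_polynomial_function:
  fixes f :: "'a::euclidean_space \<Rightarrow> real"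
  assumes "real_polynomial_function f"
  shows "f \<in> borel_measurable borel"
  using assms
  by (intro borel_measurable_continuous_onI) (simp add: continuous_on_polymonial_function real_polynomial_function_eq)

lemma integrable_polynomial_hwt:
  fixes f :: "(real ^ 'n::finite) \<times> real \<Rightarrow> real"
  assumes f: "real_polynomial_function f" and p: "-1 < p" and q: "-1 < q"
  shows "integrable lborel (\<lambda>z. f z * hwt \<rho> p q z)"
proof -
  note [measurable] = borel_measurable_real_polynomial_function[OF f]
  obtain C where C: "0 \<le> C" "\<And>z. z \<in> cball 0 1 \<times> cball 0 (sqrt (\<rho>\<^sup>2 + 1)) \<Longrightarrow> \<bar>f z\<bar> \<le> C"
    using real_polynomial_function_bounded_on_support[OF f, where \<rho>=\<rho>] by blast
  have "\<bar>f z * hwt \<rho> p q z\<bar> \<le> C * hwt \<rho> p q z" for z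
  proof (cases "hwt \<rho> p q z = 0")
    case False
    then have "z \<in> cball 0 1 \<times> cball 0 (sqrt (\<rho>\<^sup>2 + 1))"
      by (intro mem_support_hwt) (auto simp: hwt_def not_less intro: ccontr)
    then show ?thesis
      by (auto simp: abs_mult intro: mult_right_mono C)
  qed simp
  then have bound: "norm (f z * hwt \<rho> p q z) \<le> norm (C * hwt \<rho> p q z)" for z
    using C(1) by (simp add: abs_mult)
  have "integrable lborel (\<lambda>z :: (real ^ 'n) \<times> real. C * hwt \<rho> p q z)"
    by (intro integrable_mult_right integrable_hwt p q)
  moreover have "(\<lambda>z. f z * hwt \<rho> p q z) \<in> borel_measurable lborel"
    by measurable
  ultimately show ?thesis
    by (rule Bochner_Integration.integrable_bound) (rule AE_I2, rule bound)
qed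

section \<open>Integration by parts in x and in t\<close>

lemma finite_square_eq: "finite {s::real. (s + c)\<^sup>2 = d}"
proof (rule finite_subset)
  show "{s. (s + c)\<^sup>2 = d} \<subseteq> {sqrt d - c, - sqrt d - c}"
  proof
    fix s assume "s \<in> {s. (s + c)\<^sup>2 = d}"
    then have "sqrt d = \<bar>s + c\<bar>" by auto
    then show "s \<in> {sqrt d - c, - sqrt d - c}" by (auto simp: abs_if split: if_splits)
  qed
qed simp

lemma real_polynomial_function_coords [intro, simp]:
  "real_polynomial_function (\<lambda>z::(real ^ 'n::finite) \<times> real. fst z $ i)"
  "real_polynomial_function (\<lambda>z::(real ^ 'n::finite) \<times> real. snd z)"
  by (auto intro!: real_polynomial_function.intros(1) bounded_linear_compose[OF bounded_linear_vec_nth]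
      bounded_linear_fst bounded_linear_snd)

lemmas rpf_intros = real_polynomial_function_coords real_polynomial_function.intros(2-4)
  real_polynomial_function_diff real_polynomial_function_minus real_polynomial_function_sum
  real_polynomial_function_prod real_polynomial_function_power finite_class.finite_UNIV

text \<open>In terms of r this is a = r - |x|^2, and \<open>bgap\<close> is b = 1 - r; the weight is
  |t| b^p a^q on the region where both are positive.\<close>

definition agap :: "real \<Rightarrow> (real ^ 'n::finite) \<times> real \<Rightarrow> real" where
  "agap \<rho> z = (snd z)\<^sup>2 - \<rho>\<^sup>2 - (norm (fst z))\<^sup>2"

definition bgap :: "real \<Rightarrow> (real ^ 'n::finite) \<times> real \<Rightarrow> real" where
  "bgap \<rho> z = \<rho>\<^sup>2 + 1 - (snd z)\<^sup>2"

lemma hwt_eq: "hwt \<rho> p q z = \<bar>snd z\<bar> * pospow p (bgap \<rho> z) * pospow q (agap \<rho> z)"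
  by (simp add: hwt_def agap_def bgap_def)

lemma norm_power2_eq_sum: "(norm (x :: real ^ 'n::finite))\<^sup>2 = (\<Sum>i\<in>UNIV. (x $ i)\<^sup>2)"
  by (simp add: norm_vec_def L2_set_def sum_nonneg)

lemma real_polynomial_function_gaps [intro, simp]:
  "real_polynomial_function (agap \<rho>)" "real_polynomial_function (bgap \<rho>)"
  unfolding agap_def bgap_def norm_power2_eq_sum
  by (intro rpf_intros)+

text \<open>The completed square shows that a has at most two zeros on such a line; these are the
  exceptional points for differentiation in x.\<close>

lemma agap_x_line:
  "agap \<rho> (z + s *\<^sub>R (axis i 1, 0)) = agap \<rho> z + (fst z $ i)\<^sup>2 - (s + fst z $ i)\<^sup>2"
proof -
  have "(norm (fst z + s *\<^sub>R axis i 1))\<^sup>2 = (norm (fst z))\<^sup>2 + 2 * s * (fst z $ i) + s\<^sup>2"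
    by (simp only: power2_norm_eq_inner)
       (simp add: inner_add_left inner_add_right inner_axis inner_axis' power2_eq_square algebra_simps)
  then show ?thesis
    by (simp add: agap_def power2_eq_square algebra_simps)
qed

text \<open>The derivative that integrates to zero is that of f |t| b^p a^(q+1). Only a varies with
  the i-th coordinate, with derivative -2 times that coordinate, so raising its exponent alone gives
  continuity along the line, and a^q factors out afterwards.\<close>

lemma hyp_integral_x_derivative:
  fixes f f' :: "(real ^ 'n::finite) \<times> real \<Rightarrow> real"
  assumes f: "real_polynomial_function f" and f': "real_polynomial_function f'"
    and p: "-1 < p" and q: "-1 < q"
    and deriv: "\<And>z s. ((\<lambda>s. f (z + s *\<^sub>R (axis i 1, 0))) has_real_derivative f' (z + s *\<^sub>R (axis i 1, 0))) (at s)"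
  shows "hyp_integral \<rho> p q (\<lambda>z. agap \<rho> z * f' z - 2 * (q + 1) * (fst z $ i * f z)) = 0"
  unfolding hyp_integral_def
proof (rule integral_directional_derivative_eq_0)
  let ?v = "(axis i 1, 0) :: (real ^ 'n) \<times> real"
  let ?G = "\<lambda>z. f z * (\<bar>snd z\<bar> * pospow p (bgap \<rho> z)) * pospow (q + 1) (agap \<rho> z)"
  let ?g = "\<lambda>z. (agap \<rho> z * f' z - 2 * (q + 1) * (fst z $ i * f z)) * hwt \<rho> p q z"
  have "?G = (\<lambda>z. (f z * agap \<rho> z) * hwt \<rho> p q z)"
    by (simp add: fun_eq_iff hwt_eq pospow_add_1 mult_ac)
  then show "integrable lborel ?G"
    using integrable_polynomial_hwt[of "\<lambda>z. f z * agap \<rho> z" p q \<rho>] f p q by auto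
  show "integrable lborel ?g"
    using f f' p q by (intro integrable_polynomial_hwt rpf_intros real_polynomial_function_gaps) auto
  have bline: "bgap \<rho> (z + s *\<^sub>R ?v) = bgap \<rho> z" and tline: "snd (z + s *\<^sub>R ?v) = snd z" for z s
    by (simp_all add: bgap_def)
  fix z
  have "continuous_on UNIV (\<lambda>s. f (z + s *\<^sub>R ?v))"
    using deriv by (meson DERIV_continuous continuous_at_imp_continuous_on)
  then show "continuous_on UNIV (\<lambda>s. ?G (z + s *\<^sub>R ?v))"
    unfolding bline tline agap_x_line using q by (intro continuous_intros) auto
  let ?S = "{s. (s + fst z $ i)\<^sup>2 = agap \<rho> z + (fst z $ i)\<^sup>2}"
  show "\<exists>S. finite S \<and> (\<forall>s. s \<notin> S \<longrightarrow>
      ((\<lambda>s. ?G (z + s *\<^sub>R ?v)) has_real_derivative ?g (z + s *\<^sub>R ?v)) (at s))"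
  proof (intro exI[of _ ?S] conjI allI impI)
    show "finite ?S" by (rule finite_square_eq)
    fix s assume "s \<notin> ?S"
    then have nz: "agap \<rho> (z + s *\<^sub>R ?v) \<noteq> 0"
      by (simp only: agap_x_line) simp
    have "((\<lambda>s. agap \<rho> (z + s *\<^sub>R ?v)) has_real_derivative - 2 * (s + fst z $ i)) (at s)"
      unfolding agap_x_line by (auto intro!: derivative_eq_intros)
    from DERIV_chain2[OF DERIV_pospow[OF nz, of "q + 1"] this]
    have "((\<lambda>s. pospow (q + 1) (agap \<rho> (z + s *\<^sub>R ?v))) has_real_derivative
        (q + 1) * pospow q (agap \<rho> (z + s *\<^sub>R ?v)) * (- 2 * (s + fst z $ i))) (at s)"
      by simp
    from DERIV_mult[OF DERIV_cmult_right[OF deriv[of z s], of "\<bar>snd z\<bar> * pospow p (bgap \<rho> z)"] this]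
    have "((\<lambda>s. ?G (z + s *\<^sub>R ?v)) has_real_derivative
        f' (z + s *\<^sub>R ?v) * (\<bar>snd z\<bar> * pospow p (bgap \<rho> z)) * pospow (q + 1) (agap \<rho> (z + s *\<^sub>R ?v))
        + (q + 1) * pospow q (agap \<rho> (z + s *\<^sub>R ?v)) * (- 2 * (s + fst z $ i))
          * (f (z + s *\<^sub>R ?v) * (\<bar>snd z\<bar> * pospow p (bgap \<rho> z)))) (at s)"
      unfolding bline tline .
    then show "((\<lambda>s. ?G (z + s *\<^sub>R ?v)) has_real_derivative ?g (z + s *\<^sub>R ?v)) (at s)"
      by (rule DERIV_cong) (unfold hwt_eq bline tline pospow_add_1, simp add: axis_def algebra_simps)
  qed
qed

lemma continuous_on_sgn_mult:
  fixes h :: "real \<Rightarrow> real"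
  assumes h: "continuous_on UNIV h" and "h 0 = 0"
  shows "continuous_on UNIV (\<lambda>t. sgn t * h t)"
proof -
  have "continuous_on ({t. t \<le> 0} \<union> {t. 0 \<le> t}) (\<lambda>t. if t \<le> 0 then - h t else h t)"
    by (rule continuous_on_cases)
       (use assms in \<open>auto intro!: continuous_intros closed_Collect_le intro: continuous_on_subset[OF h]\<close>)
  moreover have "{t. t \<le> 0} \<union> {t. 0 \<le> t} = (UNIV :: real set)" by auto
  moreover have "(\<lambda>t. if t \<le> 0 then - h t else h t) = (\<lambda>t. sgn t * h t)"
    using assms by (auto simp: fun_eq_iff sgn_if)
  ultimately show ?thesis by (simp only:)
qed

text \<open>Here \<open>f'\<close> is the derivative of \<open>f\<close> in r, because the
  derivative in t is 2 t times the one in r. The function differentiated is sgn t b^(p+1) a^(q+1) f: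
  the sign turns 2 t into 2 |t| and so restores the factor |t| of the weight, while a and b have
  r-derivatives 1 and -1.\<close>

lemma hyp_integral_t_derivative:
  fixes f f' :: "(real ^ 'n::finite) \<times> real \<Rightarrow> real"
  assumes f: "real_polynomial_function f" and f': "real_polynomial_function f'"
    and p: "-1 < p" and q: "-1 < q"
    and deriv: "\<And>x t. ((\<lambda>t. f (x, t)) has_real_derivative 2 * t * f' (x, t)) (at t)"
  shows "hyp_integral \<rho> p q (\<lambda>z. agap \<rho> z * bgap \<rho> z * f' z + (q + 1) * bgap \<rho> z * f z - (p + 1) * agap \<rho> z * f z) = 0"
proof -
  let ?v = "(0, 1) :: (real ^ 'n) \<times> real"
  define h where "h z = pospow (p + 1) (bgap \<rho> z) * pospow (q + 1) (agap \<rho> z) * f z" for z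
  define G where "G z = sgn (snd z) * h z" for z
  let ?e = "\<lambda>z. agap \<rho> z * bgap \<rho> z * f' z + (q + 1) * bgap \<rho> z * f z - (p + 1) * agap \<rho> z * f z"
  have "(LINT z|lborel. 2 * (?e z * hwt \<rho> p q z)) = 0"
  proof (rule integral_directional_derivative_eq_0)
    show "integrable lborel G"
    proof -
      have [measurable]: "f \<in> borel_measurable borel" "agap \<rho> \<in> borel_measurable borel" "bgap \<rho> \<in> borel_measurable borel"
        using f by (auto intro: borel_measurable_real_polynomial_function)
      have [measurable]: "G \<in> borel_measurable borel"
      proof -
        have [measurable]: "(sgn :: real \<Rightarrow> real) \<in> borel_measurable borel"
          unfolding sgn_real_def[abs_def] by measurable
        have [measurable]: "(snd :: (real ^ 'n) \<times> real \<Rightarrow> real) \<in> borel_measurable borel"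
          by (intro borel_measurable_continuous_onI continuous_intros)
        show ?thesis
          unfolding G_def h_def by measurable
      qed
      obtain C where C: "0 \<le> C" "\<And>z. z \<in> cball 0 1 \<times> cball 0 (sqrt (\<rho>\<^sup>2 + 1)) \<Longrightarrow> \<bar>f z\<bar> \<le> C"
        using real_polynomial_function_bounded_on_support[OF f, where \<rho>=\<rho>] by blast
      let ?K = "cball 0 1 \<times> cball 0 (sqrt (\<rho>\<^sup>2 + 1)) :: ((real ^ 'n) \<times> real) set"
      have bound: "\<bar>G z\<bar> \<le> C * indicator ?K z" for z
      proof (cases "0 < agap \<rho> z \<and> 0 < bgap \<rho> z")
        case True
        then have z: "z \<in> ?K"
          unfolding agap_def bgap_def by (intro mem_support_hwt) auto
        \<comment> \<open>The sum is 1 - |x|^2. With both gaps positive, each is at most 1, so both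
          powers with raised exponents are at most 1 and \<open>G\<close> is bounded with compact
          support.\<close>
        have "agap \<rho> z + bgap \<rho> z \<le> 1"
          by (simp add: agap_def bgap_def)
        then have "agap \<rho> z \<le> 1" "bgap \<rho> z \<le> 1"
          using True by linarith+
        then have "pospow (p + 1) (bgap \<rho> z) \<le> 1" "pospow (q + 1) (agap \<rho> z) \<le> 1"
          using True p q by (auto simp: pospow_pos intro!: powr_le1)
        then have "pospow (p + 1) (bgap \<rho> z) * pospow (q + 1) (agap \<rho> z) * \<bar>f z\<bar> \<le> 1 * 1 * C"
          using C(2)[OF z] by (intro mult_mono) auto
        then have "\<bar>h z\<bar> \<le> C"
          by (simp add: h_def abs_mult)
        moreover have "\<bar>G z\<bar> \<le> \<bar>h z\<bar>"
          by (simp add: G_def abs_mult sgn_if)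
        ultimately show ?thesis
          using z by simp
      next
        case False
        then have "G z = 0"
          by (auto simp: G_def h_def not_less)
        then show ?thesis
          using C(1) by simp
      qed
      have "compact ?K"
        by (intro compact_Times compact_cball)
      then have "integrable lborel (indicator ?K :: _ \<Rightarrow> real)"
        by (intro integrable_real_indicator) (auto intro: borel_compact emeasure_bounded_finite[unfolded infinity_ennreal_def] compact_imp_bounded)
      then have "integrable lborel (\<lambda>z. C * indicator ?K z)"
        by simp
      then show ?thesis
        by (rule Bochner_Integration.integrable_bound) (use bound C in auto)
    qed
    show "integrable lborel (\<lambda>z. 2 * (?e z * hwt \<rho> p q z))"
      using f f' p q
      by (intro integrable_mult_right integrable_polynomial_hwt rpf_intros real_polynomial_function_gaps) auto
    fix z :: "(real ^ 'n) \<times> real"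
    have zeq: "z + s *\<^sub>R ?v = (fst z, snd z + s)" for s
      by (cases z) simp
    have ft: "continuous_on UNIV (\<lambda>t. f (x, t))" for x
      using deriv by (meson DERIV_continuous continuous_at_imp_continuous_on)
    have "continuous_on UNIV (\<lambda>t. h (x, t))" for x
      unfolding h_def agap_def bgap_def using p q by (auto intro!: continuous_intros ft)
    \<comment> \<open>At t = 0 the first gap is -\<rho>^2 - |x|^2 <= 0, so its truncated power
      vanishes; this absorbs the jump of the sign function.\<close>
    moreover have "h (x, 0) = 0" for x
      by (simp add: h_def agap_def)
    ultimately have "continuous_on UNIV (\<lambda>t. sgn t * h (x, t))" for x
      by (intro continuous_on_sgn_mult)
    from continuous_on_compose2[OF this[of "fst z"], of UNIV "\<lambda>s. snd z + s"]
    show "continuous_on UNIV (\<lambda>s. G (z + s *\<^sub>R ?v))"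
      unfolding zeq G_def by (simp add: continuous_on_add)
    \<comment> \<open>The three sets describe t = 0, a = 0 and b = 0: the jump of the sign and the
      two boundary pieces.\<close>
    let ?S = "{s. (s + snd z)\<^sup>2 = 0} \<union> {s. (s + snd z)\<^sup>2 = \<rho>\<^sup>2 + (norm (fst z))\<^sup>2} \<union> {s. (s + snd z)\<^sup>2 = \<rho>\<^sup>2 + 1}"
    show "\<exists>S. finite S \<and> (\<forall>s. s \<notin> S \<longrightarrow> ((\<lambda>s. G (z + s *\<^sub>R ?v)) has_real_derivative
        2 * (?e (z + s *\<^sub>R ?v) * hwt \<rho> p q (z + s *\<^sub>R ?v))) (at s))"
    proof (intro exI[of _ ?S] conjI allI impI)
      show "finite ?S" by (intro finite_UnI finite_square_eq)
      fix s assume s: "s \<notin> ?S"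
      define t where "t = snd z + s"
      have t0: "t \<noteq> 0" and a0: "agap \<rho> (fst z, t) \<noteq> 0" and b0: "bgap \<rho> (fst z, t) \<noteq> 0"
        using s by (auto simp: t_def agap_def bgap_def add.commute)
      have da: "((\<lambda>t. agap \<rho> (fst z, t)) has_real_derivative 2 * t) (at t)"
        and db: "((\<lambda>t. bgap \<rho> (fst z, t)) has_real_derivative - 2 * t) (at t)"
        unfolding agap_def bgap_def by (auto intro!: derivative_eq_intros)
      have ds: "((\<lambda>t. sgn t) has_real_derivative 0) (at t)"
      proof (cases "t > 0")
        case True
        show ?thesis
          by (rule has_field_derivative_transform_within_open[where S="{0<..}" and f="\<lambda>_. 1"]) (use True in auto)
      next
        case False
        show ?thesis
          by (rule has_field_derivative_transform_within_open[where S="{..<0}" and f="\<lambda>_. -1"]) (use False t0 in auto)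
      qed
      have "((\<lambda>t. G (fst z, t)) has_real_derivative 2 * (?e (fst z, t) * hwt \<rho> p q (fst z, t))) (at t)"
        unfolding G_def h_def fst_conv snd_conv
        by (rule DERIV_cong[OF DERIV_mult[OF ds DERIV_mult[OF DERIV_mult[OF DERIV_chain2[OF DERIV_pospow[OF b0] db]
              DERIV_chain2[OF DERIV_pospow[OF a0] da]] deriv[of "fst z" t]]]])
           (simp only: hwt_eq pospow_add_1 abs_sgn fst_conv snd_conv add_diff_cancel_right', simp add: algebra_simps)
      then have "((\<lambda>s. G (fst z, snd z + s)) has_real_derivative 2 * (?e (fst z, t) * hwt \<rho> p q (fst z, t))) (at s)"
        unfolding t_def by (simp only: add.commute[of "snd z"] DERIV_shift)
      then show "((\<lambda>s. G (z + s *\<^sub>R ?v)) has_real_derivative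
          2 * (?e (z + s *\<^sub>R ?v) * hwt \<rho> p q (z + s *\<^sub>R ?v))) (at s)"
        unfolding zeq t_def .
    qed
  qed
  then show ?thesis
    by (simp add: hyp_integral_def)
qed

subsection \<open>Moment recurrences and symmetry\<close>

definition xmono :: "('n \<Rightarrow> nat) \<Rightarrow> real ^ 'n::finite \<Rightarrow> real" where
  "xmono \<alpha> x = (\<Prod>i\<in>UNIV. x $ i ^ \<alpha> i)"

definition hmono :: "real \<Rightarrow> ('n \<Rightarrow> nat) \<Rightarrow> nat \<Rightarrow> (real ^ 'n::finite) \<times> real \<Rightarrow> real" where
  "hmono \<rho> \<alpha> k z = xmono \<alpha> (fst z) * ((snd z)\<^sup>2 - \<rho>\<^sup>2) ^ k"

lemma xmono_split: "xmono (\<alpha>(i := m)) x = x $ i ^ m * (\<Prod>j\<in>UNIV - {i}. x $ j ^ \<alpha> j)"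
  unfolding xmono_def by (subst prod.remove[of _ i]) auto

lemma xmono_Suc: "xmono (\<alpha>(i := Suc m)) x = x $ i * xmono (\<alpha>(i := m)) x"
  by (simp add: xmono_split)

lemma xmono_mult: "xmono \<alpha> x * xmono \<beta> x = xmono (\<lambda>i. \<alpha> i + \<beta> i) x"
  by (simp add: xmono_def power_add prod.distrib)

lemma hmono_mult: "hmono \<rho> \<alpha> k z * hmono \<rho> \<beta> l z = hmono \<rho> (\<lambda>i. \<alpha> i + \<beta> i) (k + l) z"
  by (simp add: hmono_def xmono_mult[symmetric] power_add)

lemma hmono_Suc_x: "hmono \<rho> (\<alpha>(i := Suc m)) k z = fst z $ i * hmono \<rho> (\<alpha>(i := m)) k z"
  by (simp add: hmono_def xmono_Suc)

lemma hmono_Suc_r: "hmono \<rho> \<alpha> (Suc k) z = ((snd z)\<^sup>2 - \<rho>\<^sup>2) * hmono \<rho> \<alpha> k z"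
  by (simp add: hmono_def)

lemma real_polynomial_function_hmono [intro, simp]: "real_polynomial_function (hmono \<rho> \<alpha> k)"
  unfolding hmono_def xmono_def by (intro rpf_intros)+

lemma DERIV_xmono_line:
  "((\<lambda>s. xmono \<alpha> (x + s *\<^sub>R axis i 1)) has_real_derivative
     real (\<alpha> i) * xmono (\<alpha>(i := \<alpha> i - 1)) (x + s *\<^sub>R axis i 1)) (at s)"
proof -
  define c where "c = (\<Prod>j\<in>UNIV - {i}. x $ j ^ \<alpha> j)"
  have eq: "xmono (\<alpha>(i := m)) (x + s *\<^sub>R axis i 1) = (x $ i + s) ^ m * c" for m s
    unfolding xmono_split c_def by (intro arg_cong2[of _ _ _ _ "(*)"] prod.cong) (auto simp: axis_def)
  have "((\<lambda>s. (x $ i + s) ^ \<alpha> i * c) has_real_derivative real (\<alpha> i) * ((x $ i + s) ^ (\<alpha> i - 1) * c)) (at s)"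
    by (auto intro!: derivative_eq_intros)
  then show ?thesis
    using eq[of "\<alpha> i"] eq[of "\<alpha> i - 1"] by simp
qed

lemma hyp_integral_add:
  assumes "real_polynomial_function f" "real_polynomial_function g" "-1 < p" "-1 < q"
  shows "hyp_integral \<rho> p q (\<lambda>z. f z + g z) = hyp_integral \<rho> p q f + hyp_integral \<rho> p q g"
  using assms unfolding hyp_integral_def distrib_right
  by (intro Bochner_Integration.integral_add integrable_polynomial_hwt)

lemma hyp_integral_diff:
  assumes "real_polynomial_function f" "real_polynomial_function g" "-1 < p" "-1 < q"
  shows "hyp_integral \<rho> p q (\<lambda>z. f z - g z) = hyp_integral \<rho> p q f - hyp_integral \<rho> p q g"
  using assms unfolding hyp_integral_def left_diff_distrib
  by (intro Bochner_Integration.integral_diff integrable_polynomial_hwt)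

lemma hyp_integral_cmult: "hyp_integral \<rho> p q (\<lambda>z. c * f z) = c * hyp_integral \<rho> p q f"
  by (simp add: hyp_integral_def mult.assoc)

lemma hyp_integral_sum:
  assumes "\<And>i. i \<in> I \<Longrightarrow> real_polynomial_function (f i)" "-1 < p" "-1 < q"
  shows "hyp_integral \<rho> p q (\<lambda>z. \<Sum>i\<in>I. f i z) = (\<Sum>i\<in>I. hyp_integral \<rho> p q (f i))"
  using assms unfolding hyp_integral_def sum_distrib_right
  by (intro Bochner_Integration.integral_sum integrable_polynomial_hwt)

text \<open>The image of the monomial with index (\<alpha>, k) under L, written out as a polynomial
  and therefore meaningful at t = 0 as well. The truncated subtractions do no harm: the coefficients
  vanish when \<open>\<alpha> i\<close> is 0 or 1, respectively when k = 0. For p = \<gamma> - 1/2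
  and q = \<mu> - 1/2, the last factor contains 2p + 2q + 2 = 2\<gamma> + 2\<mu>.\<close>

definition hyp_op :: "real \<Rightarrow> real \<Rightarrow> real \<Rightarrow> ('n \<Rightarrow> nat) \<Rightarrow> nat \<Rightarrow> (real ^ 'n::finite) \<times> real \<Rightarrow> real" where
  "hyp_op \<rho> p q \<alpha> k z =
     (\<Sum>i\<in>UNIV. real (\<alpha> i) * (real (\<alpha> i) - 1) * hmono \<rho> (\<alpha>(i := \<alpha> i - 2)) k z)
     + 2 * real k * (2 * real k + 2 * real (\<Sum>i\<in>UNIV. \<alpha> i) + real CARD('n) + 2 * q) * hmono \<rho> \<alpha> (k - 1) z
     - (real (\<Sum>i\<in>UNIV. \<alpha> i) + 2 * real k) * (real (\<Sum>i\<in>UNIV. \<alpha> i) + 2 * real k + 2 * p + 2 * q + 2 + real CARD('n))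
       * hmono \<rho> \<alpha> k z"

context
  fixes \<rho> p q :: real
  assumes p: "-1 < p" and q: "-1 < q"
begin

lemmas hyp_integral_simps = hyp_integral_add[OF _ _ p q] hyp_integral_diff[OF _ _ p q] hyp_integral_sum[OF _ p q] hyp_integral_cmult

lemma hyp_integral_agap_x:
  fixes \<alpha> :: "'n::finite \<Rightarrow> nat"
  shows "real (\<alpha> i) * hyp_integral \<rho> p q (\<lambda>z. agap \<rho> z * hmono \<rho> (\<alpha>(i := \<alpha> i - 1)) k z)
    = 2 * (q + 1) * hyp_integral \<rho> p q (hmono \<rho> (\<alpha>(i := Suc (\<alpha> i))) k)"
proof -
  let ?f' = "\<lambda>z. real (\<alpha> i) * hmono \<rho> (\<alpha>(i := \<alpha> i - 1)) k z"
  have "hyp_integral \<rho> p q (\<lambda>z. agap \<rho> z * ?f' z - 2 * (q + 1) * (fst z $ i * hmono \<rho> \<alpha> k z)) = 0"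
  proof (rule hyp_integral_x_derivative[OF _ _ p q])
    show "real_polynomial_function ?f'"
      by (intro rpf_intros) auto
    fix z :: "(real ^ 'n) \<times> real" and s :: real
    show "((\<lambda>s. hmono \<rho> \<alpha> k (z + s *\<^sub>R (axis i 1, 0))) has_real_derivative ?f' (z + s *\<^sub>R (axis i 1, 0))) (at s)"
      using DERIV_cmult_right[OF DERIV_xmono_line[of \<alpha> "fst z" i s], of "((snd z)\<^sup>2 - \<rho>\<^sup>2) ^ k"]
      by (simp add: hmono_def mult.assoc)
  qed simp
  also have "(\<lambda>z. agap \<rho> z * ?f' z - 2 * (q + 1) * (fst z $ i * hmono \<rho> \<alpha> k z)) =
      (\<lambda>z. real (\<alpha> i) * (agap \<rho> z * hmono \<rho> (\<alpha>(i := \<alpha> i - 1)) k z)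
        - (2 * (q + 1)) * hmono \<rho> (\<alpha>(i := Suc (\<alpha> i))) k z)"
    by (simp only: hmono_Suc_x fun_upd_triv mult_ac)
  also have "hyp_integral \<rho> p q \<dots> = real (\<alpha> i) * hyp_integral \<rho> p q (\<lambda>z. agap \<rho> z * hmono \<rho> (\<alpha>(i := \<alpha> i - 1)) k z)
      - 2 * (q + 1) * hyp_integral \<rho> p q (hmono \<rho> (\<alpha>(i := Suc (\<alpha> i))) k)"
    by (subst hyp_integral_simps) (auto intro!: rpf_intros simp: hyp_integral_cmult)
  finally show ?thesis by simp
qed

text \<open>With exponent 0 in direction i the left side of the x-recurrence is zero, and q + 1 > 0.
  This covers the exponent 1, which cannot be lowered by two.\<close>

lemma hyp_integral_hmono_odd:
  fixes \<alpha> :: "'n::finite \<Rightarrow> nat"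
  assumes "\<alpha> i = 1"
  shows "hyp_integral \<rho> p q (hmono \<rho> \<alpha> k) = 0"
proof -
  define \<beta> where "\<beta> = \<alpha>(i := 0)"
  have "\<beta> i = 0" "\<beta>(i := Suc (\<beta> i)) = \<alpha>"
    using assms by (auto simp: \<beta>_def)
  then show ?thesis
    using hyp_integral_agap_x[of \<beta> i k] q by simp
qed

text \<open>Raise each exponent by one in the x-recurrence and sum over i. Since |x|^2 = r - a, the
  moment with a reappears on the right; moving it to the left adds 2q + 2 to its factor.\<close>

lemma hyp_integral_agap:
  fixes \<alpha> :: "'n::finite \<Rightarrow> nat"
  shows "(real (\<Sum>i\<in>UNIV. \<alpha> i) + real CARD('n) + 2 * q + 2) * hyp_integral \<rho> p q (\<lambda>z. agap \<rho> z * hmono \<rho> \<alpha> k z)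
    = 2 * (q + 1) * hyp_integral \<rho> p q (hmono \<rho> \<alpha> (Suc k))"
proof -
  let ?A = "hyp_integral \<rho> p q (\<lambda>z. agap \<rho> z * hmono \<rho> \<alpha> k z)"
  have sq: "hmono \<rho> (\<alpha>(i := Suc (Suc (\<alpha> i)))) k z = (fst z $ i)\<^sup>2 * hmono \<rho> \<alpha> k z" for i z
    by (simp add: hmono_Suc_x power2_eq_square mult.assoc)
  have "(real (\<Sum>i\<in>UNIV. \<alpha> i) + real CARD('n)) * ?A = (\<Sum>i\<in>UNIV. real (Suc (\<alpha> i)) * ?A)"
    by (simp add: sum_distrib_right distrib_right sum.distrib)
  also have "\<dots> = (\<Sum>i\<in>UNIV. 2 * (q + 1) * hyp_integral \<rho> p q (hmono \<rho> (\<alpha>(i := Suc (Suc (\<alpha> i)))) k))"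
  proof (rule sum.cong)
    fix i
    show "real (Suc (\<alpha> i)) * ?A = 2 * (q + 1) * hyp_integral \<rho> p q (hmono \<rho> (\<alpha>(i := Suc (Suc (\<alpha> i)))) k)"
      using hyp_integral_agap_x[of "\<alpha>(i := Suc (\<alpha> i))" i k] by simp
  qed simp
  also have "\<dots> = 2 * (q + 1) * hyp_integral \<rho> p q (\<lambda>z. \<Sum>i\<in>UNIV. hmono \<rho> (\<alpha>(i := Suc (Suc (\<alpha> i)))) k z)"
    by (subst hyp_integral_simps) (auto simp: sum_distrib_left)
  also have "(\<lambda>z. \<Sum>i\<in>UNIV. hmono \<rho> (\<alpha>(i := Suc (Suc (\<alpha> i)))) k z) =
      (\<lambda>z. hmono \<rho> \<alpha> (Suc k) z - agap \<rho> z * hmono \<rho> \<alpha> k z)"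
    by (simp add: sq fun_eq_iff agap_def hmono_Suc_r norm_power2_eq_sum sum_distrib_right sum_distrib_left algebra_simps)
  also have "hyp_integral \<rho> p q \<dots> = hyp_integral \<rho> p q (hmono \<rho> \<alpha> (Suc k)) - ?A"
    by (subst hyp_integral_simps) (auto intro!: rpf_intros)
  finally have "(real (\<Sum>i\<in>UNIV. \<alpha> i) + real CARD('n)) * ?A = 2 * (q + 1) * (hyp_integral \<rho> p q (hmono \<rho> \<alpha> (Suc k)) - ?A)" .
  moreover have "n * a = 2 * (q + 1) * (m - a) \<Longrightarrow> (n + 2 * q + 2) * a = 2 * (q + 1) * m" for n a m :: real
    by (simp add: algebra_simps)
  ultimately show ?thesis
    by blast
qed

text \<open>The moment with a is eliminated between the x-recurrence in the single direction i and
  its sum over all directions; 2(q + 1) is positive and cancels.\<close>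

lemma hyp_integral_hmono_x2:
  fixes \<alpha> :: "'n::finite \<Rightarrow> nat"
  shows "(real (\<Sum>i\<in>UNIV. \<alpha> i) + real CARD('n) + 2 * q + 2) * hyp_integral \<rho> p q (hmono \<rho> (\<alpha>(i := Suc (Suc (\<alpha> i)))) k)
    = real (Suc (\<alpha> i)) * hyp_integral \<rho> p q (hmono \<rho> \<alpha> (Suc k))"
proof -
  let ?s = "real (\<Sum>i\<in>UNIV. \<alpha> i) + real CARD('n) + 2 * q + 2"
  let ?A = "hyp_integral \<rho> p q (\<lambda>z. agap \<rho> z * hmono \<rho> \<alpha> k z)"
  let ?X = "hyp_integral \<rho> p q (hmono \<rho> (\<alpha>(i := Suc (Suc (\<alpha> i)))) k)"
  have eq: "real (Suc (\<alpha> i)) * ?A = 2 * (q + 1) * ?X"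
    using hyp_integral_agap_x[of "\<alpha>(i := Suc (\<alpha> i))" i k] by simp
  have "2 * (q + 1) * (?s * ?X) = ?s * (2 * (q + 1) * ?X)"
    by (rule mult.left_commute)
  also have "\<dots> = real (Suc (\<alpha> i)) * (?s * ?A)"
    unfolding eq[symmetric] by (rule mult.left_commute)
  also have "\<dots> = 2 * (q + 1) * (real (Suc (\<alpha> i)) * hyp_integral \<rho> p q (hmono \<rho> \<alpha> (Suc k)))"
    unfolding hyp_integral_agap by (rule mult.left_commute)
  finally show ?thesis
    using q by simp
qed

text \<open>A recurrence of Beta type in r. It is the integrated r-derivative, in which
  multiplication by b = 1 - r becomes a difference of consecutive moments and the moments with a are
  replaced through \<open>hyp_integral_agap\<close>.\<close>

lemma hyp_integral_hmono_r:
  fixes \<alpha> :: "'n::finite \<Rightarrow> nat"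
  shows "(2 * real k + real (\<Sum>i\<in>UNIV. \<alpha> i) + real CARD('n) + 2 * q + 2) * hyp_integral \<rho> p q (hmono \<rho> \<alpha> k)
    = (2 * real k + real (\<Sum>i\<in>UNIV. \<alpha> i) + real CARD('n) + 2 * q + 2 * p + 4) * hyp_integral \<rho> p q (hmono \<rho> \<alpha> (Suc k))"
proof -
  let ?f' = "\<lambda>z. real k * hmono \<rho> \<alpha> (k - 1) z"
  let ?A = "\<lambda>j. hyp_integral \<rho> p q (\<lambda>z. agap \<rho> z * hmono \<rho> \<alpha> j z)"
  let ?M = "\<lambda>j. hyp_integral \<rho> p q (hmono \<rho> \<alpha> j)"
  define s where "s = real (\<Sum>i\<in>UNIV. \<alpha> i) + real CARD('n) + 2 * q + 2"
  have A: "s * ?A j = 2 * (q + 1) * ?M (Suc j)" for j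
    unfolding s_def by (rule hyp_integral_agap)
  have b: "bgap \<rho> z * hmono \<rho> \<alpha> j z = hmono \<rho> \<alpha> j z - hmono \<rho> \<alpha> (Suc j) z" for z j
    by (simp add: bgap_def hmono_Suc_r algebra_simps)
  have "hyp_integral \<rho> p q (\<lambda>z. agap \<rho> z * bgap \<rho> z * ?f' z + (q + 1) * bgap \<rho> z * hmono \<rho> \<alpha> k z
      - (p + 1) * agap \<rho> z * hmono \<rho> \<alpha> k z) = 0"
  proof (rule hyp_integral_t_derivative[OF _ _ p q])
    show "real_polynomial_function ?f'"
      by (intro rpf_intros) auto
    fix x :: "real ^ 'n" and t :: real
    show "((\<lambda>t. hmono \<rho> \<alpha> k (x, t)) has_real_derivative 2 * t * ?f' (x, t)) (at t)"
      unfolding hmono_def by (auto intro!: derivative_eq_intros)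
  qed simp
  also have "(\<lambda>z. agap \<rho> z * bgap \<rho> z * ?f' z + (q + 1) * bgap \<rho> z * hmono \<rho> \<alpha> k z
      - (p + 1) * agap \<rho> z * hmono \<rho> \<alpha> k z) =
    (\<lambda>z. real k * (agap \<rho> z * (bgap \<rho> z * hmono \<rho> \<alpha> (k - 1) z)) + (q + 1) * (bgap \<rho> z * hmono \<rho> \<alpha> k z)
      - (p + 1) * (agap \<rho> z * hmono \<rho> \<alpha> k z))"
    by (simp only: mult_ac)
  also have "\<dots> = (\<lambda>z. real k * (agap \<rho> z * hmono \<rho> \<alpha> (k - 1) z - agap \<rho> z * hmono \<rho> \<alpha> (Suc (k - 1)) z)
      + (q + 1) * (hmono \<rho> \<alpha> k z - hmono \<rho> \<alpha> (Suc k) z) - (p + 1) * (agap \<rho> z * hmono \<rho> \<alpha> k z))"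
    by (simp only: b right_diff_distrib)
  also have "hyp_integral \<rho> p q \<dots> = real k * (?A (k - 1) - ?A (Suc (k - 1))) + (q + 1) * (?M k - ?M (Suc k)) - (p + 1) * ?A k"
    by (simp add: hyp_integral_simps rpf_intros del: right_diff_distrib)
  finally have 0: "real k * (?A (k - 1) - ?A (Suc (k - 1))) + (q + 1) * (?M k - ?M (Suc k)) - (p + 1) * ?A k = 0"
    by simp
  \<comment> \<open>The identity is multiplied by \<open>s\<close> because the moments with a are
    expressed only in the form \<open>s * ?A j\<close>.\<close>
  have "real k * (s * a0 - s * a1) + s * (q + 1) * (m0 - m1) - (p + 1) * (s * a2) =
      s * (real k * (a0 - a1) + (q + 1) * (m0 - m1) - (p + 1) * a2)" for a0 a1 a2 m0 m1
    by (simp add: algebra_simps)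
  from this[of "?A (k - 1)" "?A (Suc (k - 1))" "?M k" "?M (Suc k)" "?A k"]
  have E1: "real k * (s * ?A (k - 1) - s * ?A (Suc (k - 1))) + s * (q + 1) * (?M k - ?M (Suc k)) - (p + 1) * (s * ?A k) = 0"
    unfolding 0 by simp
  \<comment> \<open>\<open>Suc (k - 1)\<close> is k only for k > 0; for k = 0 both sides carry the
    factor 0.\<close>
  have E2: "real k * (s * ?A (k - 1) - s * ?A (Suc (k - 1))) = 2 * (q + 1) * (real k * (?M k - ?M (Suc k)))"
    unfolding A by (cases k) (simp_all add: algebra_simps)
  have "2 * (q + 1) * (real k * (?M k - ?M (Suc k))) + s * (q + 1) * (?M k - ?M (Suc k))
      - (p + 1) * (2 * (q + 1) * ?M (Suc k)) = 0"
    using E1 unfolding E2 A[of k] .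
  then have "(q + 1) * ((2 * real k + s) * (?M k - ?M (Suc k)) - 2 * (p + 1) * ?M (Suc k)) = 0"
    by (simp add: algebra_simps)
  then have "(2 * real k + s) * (?M k - ?M (Suc k)) - 2 * (p + 1) * ?M (Suc k) = 0"
    using q by simp
  then show ?thesis
    unfolding s_def by (simp add: algebra_simps)
qed

section \<open>Symmetry of the operator on monomials\<close>

text \<open>The moments on the right involve \<alpha>, \<beta> and k, l only through their sums, so
  exchanging the two monomials changes coefficients alone. The indices
  \<open>\<alpha> i - 2 + \<beta> i\<close> and \<open>\<alpha> i + \<beta> i - 2\<close> can differ
  only for \<open>\<alpha> i < 2\<close>, where the coefficient is zero; likewise for k = 0.\<close>

lemma hyp_integral_hyp_op:
  fixes \<alpha> \<beta> :: "'n::finite \<Rightarrow> nat"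
  shows "hyp_integral \<rho> p q (\<lambda>z. hyp_op \<rho> p q \<alpha> k z * hmono \<rho> \<beta> l z) =
    (\<Sum>i\<in>UNIV. real (\<alpha> i) * (real (\<alpha> i) - 1) * hyp_integral \<rho> p q (hmono \<rho> ((\<lambda>j. \<alpha> j + \<beta> j)(i := \<alpha> i + \<beta> i - 2)) (k + l)))
    + 2 * real k * (2 * real k + 2 * real (\<Sum>i\<in>UNIV. \<alpha> i) + real CARD('n) + 2 * q)
      * hyp_integral \<rho> p q (hmono \<rho> (\<lambda>j. \<alpha> j + \<beta> j) (k + l - 1))
    - (real (\<Sum>i\<in>UNIV. \<alpha> i) + 2 * real k) * (real (\<Sum>i\<in>UNIV. \<alpha> i) + 2 * real k + 2 * p + 2 * q + 2 + real CARD('n))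
      * hyp_integral \<rho> p q (hmono \<rho> (\<lambda>j. \<alpha> j + \<beta> j) (k + l))"
proof -
  let ?\<sigma> = "\<lambda>j. \<alpha> j + \<beta> j"
  define B where "B = 2 * real k * (2 * real k + 2 * real (\<Sum>i\<in>UNIV. \<alpha> i) + real CARD('n) + 2 * q)"
  define C where "C = (real (\<Sum>i\<in>UNIV. \<alpha> i) + 2 * real k) * (real (\<Sum>i\<in>UNIV. \<alpha> i) + 2 * real k + 2 * p + 2 * q + 2 + real CARD('n))"
  have x: "real (\<alpha> i) * (real (\<alpha> i) - 1) * hmono \<rho> (\<alpha>(i := \<alpha> i - 2)) k z * hmono \<rho> \<beta> l z =
      real (\<alpha> i) * (real (\<alpha> i) - 1) * hmono \<rho> (?\<sigma>(i := \<alpha> i + \<beta> i - 2)) (k + l) z" for i z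
  proof (cases "\<alpha> i \<ge> 2")
    case True
    then have "(\<lambda>j. (\<alpha>(i := \<alpha> i - 2)) j + \<beta> j) = ?\<sigma>(i := \<alpha> i + \<beta> i - 2)"
      by auto
    then show ?thesis
      by (simp add: mult.assoc hmono_mult)
  next
    case False
    then have "real (\<alpha> i) * (real (\<alpha> i) - 1) = 0"
      by (auto simp: numeral_2_eq_2 not_le less_Suc_eq)
    then show ?thesis by (simp only: mult_zero_left)
  qed
  have r: "B * hmono \<rho> \<alpha> (k - 1) z * hmono \<rho> \<beta> l z = B * hmono \<rho> ?\<sigma> (k + l - 1) z" for z
    by (cases k) (simp_all add: B_def mult.assoc hmono_mult)
  have op: "hyp_op \<rho> p q \<alpha> k z = (\<Sum>i\<in>UNIV. real (\<alpha> i) * (real (\<alpha> i) - 1) * hmono \<rho> (\<alpha>(i := \<alpha> i - 2)) k z)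
      + B * hmono \<rho> \<alpha> (k - 1) z - C * hmono \<rho> \<alpha> k z" for z
    by (simp only: hyp_op_def B_def C_def)
  have "(\<lambda>z. hyp_op \<rho> p q \<alpha> k z * hmono \<rho> \<beta> l z) =
      (\<lambda>z. (\<Sum>i\<in>UNIV. real (\<alpha> i) * (real (\<alpha> i) - 1) * hmono \<rho> (?\<sigma>(i := \<alpha> i + \<beta> i - 2)) (k + l) z)
        + B * hmono \<rho> ?\<sigma> (k + l - 1) z - C * hmono \<rho> ?\<sigma> (k + l) z)"
    unfolding op distrib_right left_diff_distrib sum_distrib_right x r
    by (simp only: mult.assoc hmono_mult)
  then show ?thesis
    unfolding B_def[symmetric] C_def[symmetric]
    by (simp add: hyp_integral_simps rpf_intros)
qed

text \<open>Both recurrences are taken at the index lowered by two in direction i, and the moment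
  with r-exponent S + 1 is eliminated. The right side does not depend on i, which is what allows the
  Laplacian terms to be summed over i.\<close>

lemma hyp_integral_hmono_lower_x:
  fixes \<sigma> :: "'n::finite \<Rightarrow> nat"
  assumes "\<sigma> i \<noteq> 0"
  shows "(2 * real S + real (\<Sum>i\<in>UNIV. \<sigma> i) + real CARD('n) + 2 * q) * (real (\<sigma> i) - 1) * hyp_integral \<rho> p q (hmono \<rho> (\<sigma>(i := \<sigma> i - 2)) S)
    = (real (\<Sum>i\<in>UNIV. \<sigma> i) + real CARD('n) + 2 * q)
      * (2 * real S + real (\<Sum>i\<in>UNIV. \<sigma> i) + real CARD('n) + 2 * q + 2 * p + 2) * hyp_integral \<rho> p q (hmono \<rho> \<sigma> S)"
proof (cases "\<sigma> i = 1")
  case True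
  then show ?thesis
    using hyp_integral_hmono_odd[of \<sigma> i S] by simp
next
  case False
  define \<tau> where "\<tau> = \<sigma>(i := \<sigma> i - 2)"
  have \<sigma>i: "\<sigma> i = Suc (Suc (\<tau> i))"
    using assms False by (auto simp: \<tau>_def)
  have \<sigma>: "\<tau>(i := Suc (Suc (\<tau> i))) = \<sigma>"
    unfolding \<sigma>i[symmetric] by (simp add: \<tau>_def)
  have "(\<Sum>i\<in>UNIV. \<sigma> i) = \<sigma> i + (\<Sum>j\<in>UNIV - {i}. \<sigma> j)" "(\<Sum>i\<in>UNIV. \<tau> i) = \<tau> i + (\<Sum>j\<in>UNIV - {i}. \<tau> j)"
    by (simp_all add: sum.remove)
  moreover have "(\<Sum>j\<in>UNIV - {i}. \<sigma> j) = (\<Sum>j\<in>UNIV - {i}. \<tau> j)"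
    by (intro sum.cong) (auto simp: \<tau>_def)
  ultimately have s: "real (\<Sum>i\<in>UNIV. \<tau> i) = real (\<Sum>i\<in>UNIV. \<sigma> i) - 2"
    using \<sigma>i by simp
  define n where "n = real (\<Sum>i\<in>UNIV. \<sigma> i)"
  define M0 where "M0 = hyp_integral \<rho> p q (hmono \<rho> \<tau> S)"
  define M1 where "M1 = hyp_integral \<rho> p q (hmono \<rho> \<tau> (Suc S))"
  define M where "M = hyp_integral \<rho> p q (hmono \<rho> \<sigma> S)"
  have 1: "(n + real CARD('n) + 2 * q) * M = (real (\<sigma> i) - 1) * M1"
    using hyp_integral_hmono_x2[of \<tau> i S] unfolding \<sigma> s n_def[symmetric] M1_def[symmetric] M_def[symmetric] by (simp add: \<sigma>i add_ac)
  have 2: "(2 * real S + n + real CARD('n) + 2 * q) * M0 = (2 * real S + n + real CARD('n) + 2 * q + 2 * p + 2) * M1"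
    using hyp_integral_hmono_r[of S \<tau>] unfolding s n_def[symmetric] M1_def[symmetric] M0_def[symmetric] by (simp add: add_ac)
  show ?thesis
    unfolding n_def[symmetric] M_def[symmetric] \<tau>_def[symmetric] M0_def[symmetric]
    using 1 2 by algebra
qed

text \<open>After multiplication by Q + e every moment is a multiple of M. In direction i, a(a-1) -
  b(b-1) = (a-b)(a+b-1) supplies the factor required by \<open>hyp_integral_hmono_lower_x\<close>,
  and the a - b sum to A - B. With N = A + 2k and N' = B + 2l, the lowered terms add up to (N -
  N')(Q + e)(Q + e + 2p + 2) M, which is Q + e times the difference of the diagonal terms, since Q =
  N + N'.\<close>

lemma hyp_op_symmetric:
  fixes \<alpha> \<beta> :: "'n::finite \<Rightarrow> nat"
  shows "hyp_integral \<rho> p q (\<lambda>z. hyp_op \<rho> p q \<alpha> k z * hmono \<rho> \<beta> l z) = hyp_integral \<rho> p q (\<lambda>z. hmono \<rho> \<alpha> k z * hyp_op \<rho> p q \<beta> l z)"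
proof -
  let ?\<sigma> = "\<lambda>j. \<alpha> j + \<beta> j"
  define e where "e = real CARD('n) + 2 * q"
  define A where "A = real (\<Sum>i\<in>UNIV. \<alpha> i)"
  define B where "B = real (\<Sum>i\<in>UNIV. \<beta> i)"
  define S where "S = k + l"
  define Q where "Q = 2 * real S + (A + B)"
  define M where "M = hyp_integral \<rho> p q (hmono \<rho> ?\<sigma> S)"
  define Mr where "Mr = hyp_integral \<rho> p q (hmono \<rho> ?\<sigma> (S - 1))"
  define Mx where "Mx i = hyp_integral \<rho> p q (hmono \<rho> (?\<sigma>(i := \<alpha> i + \<beta> i - 2)) S)" for i
  have AB: "real (\<Sum>i\<in>UNIV. \<alpha> i + \<beta> i) = A + B"
    by (simp add: A_def B_def sum.distrib)
  have l: "hyp_integral \<rho> p q (\<lambda>z. hyp_op \<rho> p q \<alpha> k z * hmono \<rho> \<beta> l z) =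
      (\<Sum>i\<in>UNIV. real (\<alpha> i) * (real (\<alpha> i) - 1) * Mx i) + 2 * real k * (2 * real k + 2 * A + e) * Mr
      - (A + 2 * real k) * (A + 2 * real k + 2 * p + 2 + e) * M"
    unfolding hyp_integral_hyp_op Mx_def M_def Mr_def A_def S_def e_def by (simp add: add_ac)
  have "hyp_integral \<rho> p q (\<lambda>z. hmono \<rho> \<alpha> k z * hyp_op \<rho> p q \<beta> l z) = hyp_integral \<rho> p q (\<lambda>z. hyp_op \<rho> p q \<beta> l z * hmono \<rho> \<alpha> k z)"
    by (simp add: mult.commute)
  also have "\<dots> = (\<Sum>i\<in>UNIV. real (\<beta> i) * (real (\<beta> i) - 1) * Mx i) + 2 * real l * (2 * real l + 2 * B + e) * Mr
      - (B + 2 * real l) * (B + 2 * real l + 2 * p + 2 + e) * M"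
    unfolding hyp_integral_hyp_op Mx_def M_def Mr_def B_def S_def e_def by (simp add: add_ac)
  finally have r: "hyp_integral \<rho> p q (\<lambda>z. hmono \<rho> \<alpha> k z * hyp_op \<rho> p q \<beta> l z) = \<dots>" .
  show ?thesis
  proof (cases "Q + e = 0")
    case True
    \<comment> \<open>Because d >= 1 and q > -1. Hence Q + e = 0 makes the natural number Q smaller
      than 1, so Q = 0 and both monomials are the constant 1.\<close>
    have "e > -1"
      
    proof -
      have "1 \<le> real CARD('n)"
        by (simp add: Suc_leI)
      then show ?thesis
        using q unfolding e_def by linarith
    qed
    with True have "real (2 * S + (\<Sum>i\<in>UNIV. \<alpha> i) + (\<Sum>i\<in>UNIV. \<beta> i)) < 1"
      unfolding Q_def A_def B_def of_nat_add of_nat_mult of_nat_numeral by linarith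
    then have "2 * S + (\<Sum>i\<in>UNIV. \<alpha> i) + (\<Sum>i\<in>UNIV. \<beta> i) = 0"
      by linarith
    then have "k = 0" "l = 0" "\<alpha> = (\<lambda>_. 0)" "\<beta> = (\<lambda>_. 0)"
      by (auto simp: S_def)
    then show ?thesis
      by (simp add: mult.commute)
  next
    case False
    have x: "(Q + e) * (\<Sum>i\<in>UNIV. (real (\<alpha> i) * (real (\<alpha> i) - 1) - real (\<beta> i) * (real (\<beta> i) - 1)) * Mx i)
        = (A - B) * (A + B + e) * (Q + e + 2 * p + 2) * M"
    proof -
      have "(Q + e) * ((real (\<alpha> i) * (real (\<alpha> i) - 1) - real (\<beta> i) * (real (\<beta> i) - 1)) * Mx i)
          = (real (\<alpha> i) - real (\<beta> i)) * ((A + B + e) * (Q + e + 2 * p + 2) * M)" for i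
      proof (cases "?\<sigma> i = 0")
        case False
        have "(Q + e) * ((real (\<alpha> i) + real (\<beta> i)) - 1) * Mx i = (A + B + e) * (Q + e + 2 * p + 2) * M"
          using hyp_integral_hmono_lower_x[of ?\<sigma> i S, OF False] unfolding AB Mx_def M_def e_def Q_def by (simp add: add_ac)
        then show ?thesis by algebra
      qed simp
      then show ?thesis
        by (simp add: sum_distrib_left sum_distrib_right[symmetric] sum_subtractf A_def B_def mult.assoc)
    qed
    have y: "(Q + e) * ((2 * real k * (2 * real k + 2 * A + e) - 2 * real l * (2 * real l + 2 * B + e)) * Mr)
        = (2 * real k * (2 * real k + 2 * A + e) - 2 * real l * (2 * real l + 2 * B + e)) * (Q + e + 2 * p + 2) * M"
    \<comment> \<open>For S = 0 both k and l are 0 and the bracket vanishes; otherwise the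
      r-recurrence is used at S - 1.\<close>
    proof (cases S)
      case (Suc T)
      have "(Q + e) * Mr = (Q + e + 2 * p + 2) * M"
        using hyp_integral_hmono_r[of T ?\<sigma>] unfolding AB Mr_def M_def e_def Q_def Suc by (simp add: add_ac)
      then show ?thesis by algebra
    qed (simp add: S_def)
    define X where "X = (\<Sum>i\<in>UNIV. (real (\<alpha> i) * (real (\<alpha> i) - 1) - real (\<beta> i) * (real (\<beta> i) - 1)) * Mx i)"
    have X: "(\<Sum>i\<in>UNIV. real (\<alpha> i) * (real (\<alpha> i) - 1) * Mx i) = X + (\<Sum>i\<in>UNIV. real (\<beta> i) * (real (\<beta> i) - 1) * Mx i)"
      by (simp add: X_def sum_subtractf left_diff_distrib)
    have Q: "Q = 2 * real k + 2 * real l + A + B"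
      by (simp add: Q_def S_def)
    have "(Q + e) * (X + (2 * real k * (2 * real k + 2 * A + e) - 2 * real l * (2 * real l + 2 * B + e)) * Mr
        - ((A + 2 * real k) * (A + 2 * real k + 2 * p + 2 + e) - (B + 2 * real l) * (B + 2 * real l + 2 * p + 2 + e)) * M) = 0"
      using x[folded X_def] y Q by algebra
    with False have "X + (2 * real k * (2 * real k + 2 * A + e) - 2 * real l * (2 * real l + 2 * B + e)) * Mr
        - ((A + 2 * real k) * (A + 2 * real k + 2 * p + 2 + e) - (B + 2 * real l) * (B + 2 * real l + 2 * p + 2 + e)) * M = 0"
      by (simp only: mult_eq_0_iff) blast
    then show ?thesis
      unfolding l r X left_diff_distrib by linarith
  qed
qed

end

subsection \<open>Even polynomials\<close>

text \<open>Generic in the family, which is instantiated both with the monomials in (x, t) behind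
  \<open>polys_upto\<close> and with those in (x, r).\<close>

definition fspan :: "'i set \<Rightarrow> ('i \<Rightarrow> 'b \<Rightarrow> real) \<Rightarrow> ('b \<Rightarrow> real) set" where
  "fspan I m = {f. \<exists>c. f = (\<lambda>z. \<Sum>i\<in>I. c i * m i z)}"

lemma fspanI: "f = (\<lambda>z. \<Sum>i\<in>I. c i * m i z) \<Longrightarrow> f \<in> fspan I m"
  unfolding fspan_def by blast

lemma fspan_add:
  assumes "f \<in> fspan I m" "g \<in> fspan I m"
  shows "(\<lambda>z. f z + g z) \<in> fspan I m"
proof -
  from assms obtain c d where "f = (\<lambda>z. \<Sum>i\<in>I. c i * m i z)" "g = (\<lambda>z. \<Sum>i\<in>I. d i * m i z)"
    unfolding fspan_def by blast
  then have "(\<lambda>z. f z + g z) = (\<lambda>z. \<Sum>i\<in>I. (c i + d i) * m i z)"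
    by (simp add: distrib_right sum.distrib)
  then show ?thesis
    by (rule fspanI)
qed

lemma fspan_cmult:
  assumes "f \<in> fspan I m"
  shows "(\<lambda>z. a * f z) \<in> fspan I m"
proof -
  from assms obtain c where "f = (\<lambda>z. \<Sum>i\<in>I. c i * m i z)"
    unfolding fspan_def by blast
  then have "(\<lambda>z. a * f z) = (\<lambda>z. \<Sum>i\<in>I. (a * c i) * m i z)"
    by (simp add: sum_distrib_left mult.assoc)
  then show ?thesis
    by (rule fspanI)
qed

lemma fspan_0: "(\<lambda>z. 0) \<in> fspan I m"
  unfolding fspan_def by (auto intro!: exI[of _ "\<lambda>_. 0"])

lemma fspan_sum:
  assumes "\<And>j. j \<in> J \<Longrightarrow> f j \<in> fspan I m"
  shows "(\<lambda>z. \<Sum>j\<in>J. f j z) \<in> fspan I m"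
  using assms by (induction J rule: infinite_finite_induct) (auto intro: fspan_0 fspan_add)

lemma fspan_base:
  assumes "finite I" "i \<in> I"
  shows "m i \<in> fspan I m"
proof -
  have "m i = (\<lambda>z. \<Sum>j\<in>I. (if j = i then 1 else 0) * m j z)"
    using assms by (simp add: if_distrib[of "\<lambda>c. c * _"] cong: if_cong)
  then show ?thesis
    by (rule fspanI)
qed

definition even_index :: "nat \<Rightarrow> (('n::finite \<Rightarrow> nat) \<times> nat) set" where
  "even_index n = {(\<alpha>, k). (\<Sum>i\<in>UNIV. \<alpha> i) + 2 * k \<le> n}"

lemma finite_even_index: "finite (even_index n)"
  by (rule finite_subset[OF _ finite_monomials_upto[of n]]) (auto simp: even_index_def monomials_upto_def)

abbreviation hspan :: "real \<Rightarrow> nat \<Rightarrow> ((real ^ 'n::finite) \<times> real \<Rightarrow> real) set" where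
  "hspan \<rho> n \<equiv> fspan (even_index n) (\<lambda>p. hmono \<rho> (fst p) (snd p))"

lemma hmono_in_hspan: "(\<Sum>i\<in>UNIV. \<alpha> i) + 2 * k \<le> n \<Longrightarrow> hmono \<rho> \<alpha> k \<in> hspan \<rho> n"
  using fspan_base[OF finite_even_index, of "(\<alpha>, k)" n "\<lambda>p. hmono \<rho> (fst p) (snd p)"]
  by (simp add: even_index_def)

lemma polys_upto_eq_fspan:
  "polys_upto n = fspan (monomials_upto n) (\<lambda>p z. xmono (fst p) (fst z) * snd z ^ snd p)"
  unfolding polys_upto_def fspan_def xmono_def
  by (simp add: fun_eq_iff split_beta mult.assoc)

lemma hspan_subset_polys_upto: "hspan \<rho> n \<subseteq> polys_upto n"
proof
  fix f :: "(real ^ 'n) \<times> real \<Rightarrow> real"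
  assume "f \<in> hspan \<rho> n"
  then obtain c where f: "f = (\<lambda>z. \<Sum>p\<in>even_index n. c p * hmono \<rho> (fst p) (snd p) z)"
    unfolding fspan_def by blast
  have "hmono \<rho> \<alpha> k \<in> polys_upto n" if "(\<alpha>, k) \<in> even_index n" for \<alpha> :: "'n \<Rightarrow> nat" and k
  proof -
    have "hmono \<rho> \<alpha> k = (\<lambda>z. \<Sum>j\<le>k. (real (k choose j) * (- (\<rho>\<^sup>2)) ^ (k - j)) * (xmono \<alpha> (fst z) * ((snd z)\<^sup>2) ^ j))"
    proof
      fix z :: "(real ^ 'n) \<times> real"
      have "((snd z)\<^sup>2 + - (\<rho>\<^sup>2)) ^ k = (\<Sum>j\<le>k. real (k choose j) * ((snd z)\<^sup>2) ^ j * (- (\<rho>\<^sup>2)) ^ (k - j))"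
        by (rule binomial_ring)
      then show "hmono \<rho> \<alpha> k z = (\<Sum>j\<le>k. (real (k choose j) * (- (\<rho>\<^sup>2)) ^ (k - j)) * (xmono \<alpha> (fst z) * ((snd z)\<^sup>2) ^ j))"
        by (simp add: hmono_def sum_distrib_left mult_ac)
    qed
    also have "\<dots> \<in> polys_upto n"
      unfolding polys_upto_eq_fspan
    proof (intro fspan_sum fspan_cmult)
      fix j assume "j \<in> {..k}"
      then have "(\<alpha>, 2 * j) \<in> monomials_upto n"
        using that by (auto simp: even_index_def monomials_upto_def)
      from fspan_base[OF finite_monomials_upto this, of "\<lambda>p z. xmono (fst p) (fst z) * snd z ^ snd p"]
      show "(\<lambda>z. xmono \<alpha> (fst z) * ((snd z)\<^sup>2) ^ j) \<in>
          fspan (monomials_upto n) (\<lambda>p z. xmono (fst p) (fst z) * snd z ^ snd p)"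
        by (simp only: fst_conv snd_conv power_mult)
    qed
    finally show ?thesis .
  qed
  then show "f \<in> polys_upto n"
    unfolding f polys_upto_eq_fspan by (intro fspan_sum fspan_cmult) auto
qed

text \<open>Averaging \<open>u\<close> with its reflection in t removes the odd powers of t, and the
  even ones expand by t^(2j) = (r + \<rho>^2)^j. Neither step raises the degree when r counts as
  degree two.\<close>

lemma even_polys_upto_in_hspan:
  fixes u :: "(real ^ 'n::finite) \<times> real \<Rightarrow> real"
  assumes u: "u \<in> polys_upto n" and even: "\<And>x t. u (x, - t) = u (x, t)"
  shows "u \<in> hspan \<rho> n"
proof -
  obtain c where c: "u = (\<lambda>z. \<Sum>p\<in>monomials_upto n. c p * (xmono (fst p) (fst z) * snd z ^ snd p))"
    using u unfolding polys_upto_eq_fspan fspan_def by blast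
  have "u z = (\<Sum>p\<in>monomials_upto n. c p * (xmono (fst p) (fst z) * ((snd z ^ snd p + (- snd z) ^ snd p) / 2)))" for z
  proof -
    have "u z = (u z + u (fst z, - snd z)) / 2"
      using even[of "fst z" "snd z"] by simp
    then show ?thesis
      by (simp add: c sum_divide_distrib sum.distrib[symmetric] algebra_simps add_divide_distrib)
  qed
  then have "u = (\<lambda>z. \<Sum>p\<in>monomials_upto n. c p * (xmono (fst p) (fst z) * ((snd z ^ snd p + (- snd z) ^ snd p) / 2)))"
    by blast
  also have "\<dots> \<in> hspan \<rho> n"
  proof (intro fspan_sum fspan_cmult)
    fix r :: "('n \<Rightarrow> nat) \<times> nat"
    assume "r \<in> monomials_upto n"
    then obtain \<alpha> k where r: "r = (\<alpha>, k)" and le: "(\<Sum>i\<in>UNIV. \<alpha> i) + k \<le> n"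
      by (auto simp: monomials_upto_def)
    show "(\<lambda>z. xmono (fst r) (fst z) * ((snd z ^ snd r + (- snd z) ^ snd r) / 2)) \<in> hspan \<rho> n"
    proof (cases "even k")
      case True
      then obtain j where j: "k = 2 * j" by auto
      have "(\<lambda>z. xmono (fst r) (fst z) * ((snd z ^ snd r + (- snd z) ^ snd r) / 2)) =
          (\<lambda>z. \<Sum>i\<le>j. (real (j choose i) * (\<rho>\<^sup>2) ^ (j - i)) * hmono \<rho> \<alpha> i z)"
      proof
        fix z :: "(real ^ 'n) \<times> real"
        have "snd z ^ k = (((snd z)\<^sup>2 - \<rho>\<^sup>2) + \<rho>\<^sup>2) ^ j"
          by (simp add: j power_mult)
        also have "\<dots> = (\<Sum>i\<le>j. real (j choose i) * ((snd z)\<^sup>2 - \<rho>\<^sup>2) ^ i * (\<rho>\<^sup>2) ^ (j - i))"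
          by (rule binomial_ring)
        finally show "xmono (fst r) (fst z) * ((snd z ^ snd r + (- snd z) ^ snd r) / 2) =
            (\<Sum>i\<le>j. (real (j choose i) * (\<rho>\<^sup>2) ^ (j - i)) * hmono \<rho> \<alpha> i z)"
          using True by (simp add: r hmono_def sum_distrib_left mult_ac)
      qed
      also have "\<dots> \<in> hspan \<rho> n"
        using le j by (intro fspan_sum fspan_cmult hmono_in_hspan) auto
      finally show ?thesis .
    next
      case False
      then show ?thesis
        by (simp add: r fspan_0)
    qed
  qed
  finally show ?thesis .
qed

lemma real_polynomial_function_hspan:
  assumes "f \<in> hspan \<rho> n"
  shows "real_polynomial_function f"
  using assms finite_even_index unfolding fspan_def by (auto intro!: rpf_intros)

section \<open>Definiteness of the inner product\<close>

text \<open>On the line through \<open>z0\<close> and \<open>z\<close> the function is a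
  one-variable polynomial that vanishes on a neighbourhood of the parameter 0, hence has infinitely
  many roots; the parameter 1 gives the value at \<open>z\<close>.\<close>

lemma real_polynomial_function_eq_0_if_open:
  fixes f :: "'a::euclidean_space \<Rightarrow> real"
  assumes f: "real_polynomial_function f" and U: "open U" "z0 \<in> U" and 0: "\<And>z. z \<in> U \<Longrightarrow> f z = 0"
  shows "f z = 0"
proof -
  let ?l = "\<lambda>s. z0 + s *\<^sub>R (z - z0)"
  have l: "polynomial_function ?l"
    by (intro polynomial_function_add polynomial_function_const polynomial_function_mult polynomial_function_id)
  have "real_polynomial_function (f \<circ> ?l)"
    using l f by (rule real_polynomial_function_compose)
  then obtain a n where a: "f \<circ> ?l = (\<lambda>s. \<Sum>i\<le>n. a i * s ^ i)"
    using real_polynomial_function_iff_sum by blast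
  have "open (?l -` U)"
    using U(1) by (intro open_vimage continuous_intros)
  moreover have "0 \<in> ?l -` U"
    using U(2) by simp
  ultimately have "infinite (?l -` U)"
    using finite_imp_not_open[of "?l -` U"] by blast
  moreover have "?l -` U \<subseteq> {s. (\<Sum>i\<le>n. a i * s ^ i) = 0}"
  proof
    fix s assume "s \<in> ?l -` U"
    then have "f (?l s) = 0"
      using 0 by blast
    then show "s \<in> {s. (\<Sum>i\<le>n. a i * s ^ i) = 0}"
      using fun_cong[OF a, of s] by simp
  qed
  ultimately have "infinite {s. (\<Sum>i\<le>n. a i * s ^ i) = 0}"
    using finite_subset by blast
  then have "\<forall>i\<le>n. a i = 0"
    using polyfun_finite_roots[of a n] by blast
  then show ?thesis
    using fun_cong[OF a, of 1] by simp
qed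

text \<open>The weight is positive on the open set \<open>?U\<close>. The part of \<open>?U\<close>
  where f is nonzero is open and null, hence empty, and a polynomial vanishing on a nonempty open
  set is zero.\<close>

lemma hyp_integral_square_eq_0D:
  fixes f :: "(real ^ 'n::finite) \<times> real \<Rightarrow> real"
  assumes f: "real_polynomial_function f" and p: "-1 < p" and q: "-1 < q"
    and 0: "hyp_integral \<rho> p q (\<lambda>z. f z * f z) = 0"
  shows "f z = 0"
proof -
  let ?U = "{z :: (real ^ 'n) \<times> real. 0 < agap \<rho> z \<and> 0 < bgap \<rho> z \<and> 0 < snd z}"
  let ?O = "?U \<inter> {z. f z \<noteq> 0}"
  have cont: "continuous_on UNIV f" "continuous_on UNIV (agap \<rho>)" "continuous_on UNIV (bgap \<rho>)"
    using f by (simp_all add: continuous_on_polymonial_function flip: real_polynomial_function_eq)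
  have U: "open ?U"
    using cont by (intro open_Collect_conj open_Collect_less continuous_intros) auto
  have O: "open ?O"
    using U cont by (intro open_Int open_Collect_neq continuous_intros) auto
  have "AE z in lborel. f z * f z * hwt \<rho> p q z = 0"
    using 0 integrable_polynomial_hwt[of "\<lambda>z. f z * f z" p q \<rho>] f p q
    unfolding hyp_integral_def by (subst (asm) integral_nonneg_eq_0_iff_AE) auto
  then have "AE z in lborel. z \<notin> ?O"
    by eventually_elim (auto simp: hwt_eq pospow_pos)
  then have "?O \<in> null_sets lborel"
    using O by (subst AE_iff_null_sets) auto
  then have "negligible ?O"
    by (simp add: negligible_iff_null_sets null_sets_completionI)
  then have "?O = {}"
    using open_not_negligible[OF O] by blast
  then have "f z = 0" if "z \<in> ?U" for z
    using that by blast
  \<comment> \<open>At this point x = 0 and r = 1/2, so both gaps equal 1/2.\<close>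
  moreover have "(0, sqrt (\<rho>\<^sup>2 + 1/2)) \<in> ?U"
    by (simp add: agap_def bgap_def add_nonneg_pos)
  ultimately show ?thesis
    using real_polynomial_function_eq_0_if_open[OF f U] by blast
qed

text \<open>On the hyperboloid both bases are nonnegative and truncation changes nothing; off it at
  least one base is not positive, so the truncated power acts as the indicator.\<close>

lemma hyp_inner_eq_hint:
  fixes f g :: "(real ^ 'n::finite) \<times> real \<Rightarrow> real"
  assumes "\<rho> \<ge> 0"
  shows "hyp_inner \<rho> \<gamma> \<mu> f g = hyp_integral \<rho> (\<gamma> - 1/2) (\<mu> - 1/2) (\<lambda>z. f z * g z)"
proof -
  have "indicator (double_hyperboloid \<rho>) z * hyp_weight \<rho> \<gamma> \<mu> z = hwt \<rho> (\<gamma> - 1/2) (\<mu> - 1/2) z" for z :: "(real ^ 'n) \<times> real"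
  proof (cases "z \<in> double_hyperboloid \<rho>")
    case True
    then have b: "\<bar>snd z\<bar> \<le> sqrt (\<rho>\<^sup>2 + 1)" and "(norm (fst z))\<^sup>2 \<le> (snd z)\<^sup>2 - \<rho>\<^sup>2"
      by (auto simp: double_hyperboloid_def)
    moreover have "(snd z)\<^sup>2 \<le> \<rho>\<^sup>2 + 1"
      using power_mono[OF b, of 2] by simp
    ultimately show ?thesis
      using True by (simp add: hwt_def hyp_weight_def split_beta pospow_def)
  next
    case False
    have "hwt \<rho> (\<gamma> - 1/2) (\<mu> - 1/2) z = 0"
    proof (rule ccontr)
      assume "hwt \<rho> (\<gamma> - 1/2) (\<mu> - 1/2) z \<noteq> 0"
      then have a: "0 < (snd z)\<^sup>2 - \<rho>\<^sup>2 - (norm (fst z))\<^sup>2" and b: "0 < \<rho>\<^sup>2 + 1 - (snd z)\<^sup>2"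
        by (auto simp: hwt_def not_less intro: ccontr)
      have "\<rho>\<^sup>2 \<le> \<bar>snd z\<bar>\<^sup>2"
        using a zero_le_power2[of "norm (fst z)"] unfolding power2_abs by linarith
      then have "\<rho> \<le> \<bar>snd z\<bar>"
        by (rule power2_le_imp_le) simp
      moreover have "\<bar>snd z\<bar> \<le> sqrt (\<rho>\<^sup>2 + 1)"
        using b by (intro real_le_rsqrt) auto
      ultimately show False
        using False a by (cases z) (auto simp: double_hyperboloid_def)
    qed
    with False show ?thesis by simp
  qed
  then have "indicator (double_hyperboloid \<rho>) z *\<^sub>R (f z * g z * hyp_weight \<rho> \<gamma> \<mu> z) =
      f z * g z * hwt \<rho> (\<gamma> - 1/2) (\<mu> - 1/2) z" for z
    by (metis mult.left_commute real_scaleR_def)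
  then show ?thesis
    by (simp only: hyp_inner_def hyp_integral_def set_lebesgue_integral_def)
qed

subsection \<open>The operator on even polynomials\<close>

text \<open>Sums of monomials in x whose coefficients are functions of t are preserved by the
  operators in x, and by differentiation in t when the coefficients are differentiable. Iterated
  operators are therefore computed by instantiating the same lemmas with new coefficients.\<close>

lemma partial_x_xmono_sum:
  fixes a :: "'i \<Rightarrow> 'n::finite \<Rightarrow> nat"
  shows "partial_x i (\<lambda>z. \<Sum>r\<in>I. c r (snd z) * xmono (a r) (fst z)) =
    (\<lambda>z. \<Sum>r\<in>I. (c r (snd z) * real (a r i)) * xmono ((a r)(i := a r i - 1)) (fst z))"
proof
  fix z :: "(real ^ 'n) \<times> real"
  have "((\<lambda>s. \<Sum>r\<in>I. c r (snd z) * xmono (a r) (fst z + s *\<^sub>R axis i 1)) has_real_derivative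
      (\<Sum>r\<in>I. c r (snd z) * (real (a r i) * xmono ((a r)(i := a r i - 1)) (fst z + 0 *\<^sub>R axis i 1)))) (at 0)"
    by (intro DERIV_sum DERIV_cmult DERIV_xmono_line)
  then show "partial_x i (\<lambda>z. \<Sum>r\<in>I. c r (snd z) * xmono (a r) (fst z)) z =
      (\<Sum>r\<in>I. (c r (snd z) * real (a r i)) * xmono ((a r)(i := a r i - 1)) (fst z))"
    unfolding partial_x_def by (cases z) (auto dest!: DERIV_imp_deriv simp: mult.assoc)
qed

lemma partial_t_xmono_sum:
  fixes a :: "'i \<Rightarrow> 'n::finite \<Rightarrow> nat"
  assumes "\<And>r t. r \<in> I \<Longrightarrow> (c r has_real_derivative c' r t) (at t)"
  shows "partial_t (\<lambda>z. \<Sum>r\<in>I. c r (snd z) * xmono (a r) (fst z)) =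
    (\<lambda>z. \<Sum>r\<in>I. c' r (snd z) * xmono (a r) (fst z))"
proof
  fix z :: "(real ^ 'n) \<times> real"
  have "((\<lambda>t. \<Sum>r\<in>I. c r t * xmono (a r) (fst z)) has_real_derivative
      (\<Sum>r\<in>I. c' r (snd z) * xmono (a r) (fst z))) (at (snd z))"
    by (intro DERIV_sum DERIV_cmult_right assms)
  then show "partial_t (\<lambda>z. \<Sum>r\<in>I. c r (snd z) * xmono (a r) (fst z)) z =
      (\<Sum>r\<in>I. c' r (snd z) * xmono (a r) (fst z))"
    unfolding partial_t_def by (cases z) (auto dest!: DERIV_imp_deriv)
qed

lemma coord_mult_xmono: "x $ i * (real (\<alpha> i) * xmono (\<alpha>(i := \<alpha> i - 1)) x) = real (\<alpha> i) * xmono \<alpha> x"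
proof (cases "\<alpha> i")
  case (Suc m)
  then show ?thesis
    using xmono_Suc[of \<alpha> i m x] by (simp add: fun_upd_idem)
qed simp

lemma euler_x_xmono_sum:
  fixes a :: "'i \<Rightarrow> 'n::finite \<Rightarrow> nat"
  shows "euler_x (\<lambda>z. \<Sum>r\<in>I. c r (snd z) * xmono (a r) (fst z)) =
    (\<lambda>z. \<Sum>r\<in>I. (real (\<Sum>i\<in>UNIV. a r i) * c r (snd z)) * xmono (a r) (fst z))"
proof
  fix z :: "(real ^ 'n) \<times> real"
  have "euler_x (\<lambda>z. \<Sum>r\<in>I. c r (snd z) * xmono (a r) (fst z)) z =
      (\<Sum>i\<in>UNIV. \<Sum>r\<in>I. c r (snd z) * (fst z $ i * (real (a r i) * xmono ((a r)(i := a r i - 1)) (fst z))))"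
    unfolding euler_x_def partial_x_xmono_sum by (simp add: sum_distrib_left mult_ac)
  also have "\<dots> = (\<Sum>i\<in>UNIV. \<Sum>r\<in>I. c r (snd z) * (real (a r i) * xmono (a r) (fst z)))"
    unfolding coord_mult_xmono ..
  also have "\<dots> = (\<Sum>r\<in>I. \<Sum>i\<in>UNIV. c r (snd z) * (real (a r i) * xmono (a r) (fst z)))"
    by (rule sum.swap)
  also have "\<dots> = (\<Sum>r\<in>I. (real (\<Sum>i\<in>UNIV. a r i) * c r (snd z)) * xmono (a r) (fst z))"
    unfolding of_nat_sum sum_distrib_right by (intro sum.cong refl) (simp only: mult_ac)
  finally show "euler_x (\<lambda>z. \<Sum>r\<in>I. c r (snd z) * xmono (a r) (fst z)) z = \<dots>" .
qed

lemma laplace_x_xmono_sum: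
  fixes a :: "'i \<Rightarrow> 'n::finite \<Rightarrow> nat"
  shows "laplace_x (\<lambda>z. \<Sum>r\<in>I. c r (snd z) * xmono (a r) (fst z)) z =
    (\<Sum>r\<in>I. c r (snd z) * (\<Sum>i\<in>UNIV. real (a r i) * (real (a r i) - 1) * xmono ((a r)(i := a r i - 2)) (fst z)))"
proof -
  \<comment> \<open>Natural and real subtraction disagree only at \<open>a r i = 0\<close>, where
    the leading factor is zero.\<close>
  have eq: "real (a r i) * (real (a r i - Suc 0) * X) = real (a r i) * ((real (a r i) - 1) * X)" for r i X
    by (cases "a r i") auto
  have pp: "partial_x i (partial_x i (\<lambda>z. \<Sum>r\<in>I. c r (snd z) * xmono (a r) (fst z))) z =
      (\<Sum>r\<in>I. c r (snd z) * (real (a r i) * (real (a r i) - 1) * xmono ((a r)(i := a r i - 2)) (fst z)))" for i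
  proof -
    have "partial_x i (partial_x i (\<lambda>z. \<Sum>r\<in>I. c r (snd z) * xmono (a r) (fst z))) z =
        (\<Sum>r\<in>I. (c r (snd z) * real (a r i) * real (((a r)(i := a r i - 1)) i))
          * xmono (((a r)(i := a r i - 1))(i := ((a r)(i := a r i - 1)) i - 1)) (fst z))"
      unfolding partial_x_xmono_sum[of i c a I]
      by (rule fun_cong[OF partial_x_xmono_sum[of i "\<lambda>r t. c r t * real (a r i)" "\<lambda>r. (a r)(i := a r i - 1)" I]])
    then show ?thesis
      by (simp add: mult.assoc eq numeral_2_eq_2)
  qed
  have "laplace_x (\<lambda>z. \<Sum>r\<in>I. c r (snd z) * xmono (a r) (fst z)) z =
      (\<Sum>i\<in>UNIV. \<Sum>r\<in>I. c r (snd z) * (real (a r i) * (real (a r i) - 1) * xmono ((a r)(i := a r i - 2)) (fst z)))"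
    unfolding laplace_x_def pp ..
  also have "\<dots> = (\<Sum>r\<in>I. \<Sum>i\<in>UNIV. c r (snd z) * (real (a r i) * (real (a r i) - 1) * xmono ((a r)(i := a r i - 2)) (fst z)))"
    by (rule sum.swap)
  finally show ?thesis
    by (simp add: sum_distrib_left)
qed

text \<open>Here \<open>r\<close> stands for \<open>t\<^sup>2 - \<rho>\<^sup>2\<close>, \<open>A\<close> for the degree in \<open>x\<close>, \<open>C\<close> for \<open>2\<gamma> + 2\<mu> + d + 1\<close> and \<open>e\<close> for
  \<open>2\<mu> + d\<close>; \<open>C1\<close> and \<open>C2\<close> are the first two \<open>t\<close>-derivatives of \<open>r ^ k\<close>.\<close>

lemma radial_part:
  fixes t r A C e :: real and k :: nat
  assumes t: "t \<noteq> 0"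
  defines "C1 \<equiv> real k * (r ^ (k - 1) * (2 * t))"
    and "C2 \<equiv> real k * (real (k - 1) * (r ^ (k - 1 - 1) * (2 * t)) * (2 * t) + r ^ (k - 1) * 2)"
  shows "(1 - r) * (r / t\<^sup>2) * C2 + 2 / t * (1 - r) * (A * C1) + ((1 - r) * (1 - r / t\<^sup>2) + e) * (1 / t) * C1
      - C * (r / t\<^sup>2 * t * C1)
    = 2 * real k * (2 * real k + 2 * A + (e - 1)) * r ^ (k - 1)
      - ((A + 2 * real k) * (A + 2 * real k + C - 1) - A * (A - 1 + C)) * r ^ k"
proof (cases k)
  case (Suc m)
  \<comment> \<open>The exponent \<open>k - 1 - 1\<close> in \<open>C2\<close> truncates at k = 1,
    hence the second case split.\<close>
  show ?thesis
  proof (cases m)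
    case 0
    with Suc t show ?thesis
      unfolding C1_def C2_def by (simp add: field_simps power2_eq_square)
  next
    case (Suc j)
    with \<open>k = Suc m\<close> t show ?thesis
      unfolding C1_def C2_def by (simp add: field_simps power2_eq_square)
  qed
qed (simp add: C1_def C2_def)

text \<open>By linearity a single monomial is enough. Writing 1 - \<rho>^2/t^2 as r/t^2 expresses
  the coefficients through r and t, and in \<open>radial_part\<close> the negative powers of t
  cancel against those produced by differentiating r^k.\<close>

lemma operator_on_hspan:
  fixes \<rho> \<gamma> \<mu> :: real and x :: "real ^ 'n::finite" and c :: "('n \<Rightarrow> nat) \<times> nat \<Rightarrow> real"
  assumes u: "u = (\<lambda>z. \<Sum>r\<in>I. c r * hmono \<rho> (fst r) (snd r) z)" and t: "t \<noteq> 0"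
  shows "(1 + \<rho>\<^sup>2 - t\<^sup>2) * (1 - \<rho>\<^sup>2 / t\<^sup>2) * partial_t (partial_t u) (x, t)
       + laplace_x u (x, t) - euler_x (euler_x u) (x, t) + euler_x u (x, t)
       + 2 / t * (1 + \<rho>\<^sup>2 - t\<^sup>2) * euler_x (partial_t u) (x, t)
       + ((1 + \<rho>\<^sup>2 - t\<^sup>2) * (\<rho>\<^sup>2 / t\<^sup>2) + 2 * \<mu> + real CARD('n)) * (1 / t) * partial_t u (x, t)
       - (2 * \<gamma> + 2 * \<mu> + real CARD('n) + 1)
           * ((1 - \<rho>\<^sup>2 / t\<^sup>2) * t * partial_t u (x, t) + euler_x u (x, t))
     = (\<Sum>r\<in>I. c r * hyp_op \<rho> (\<gamma> - 1/2) (\<mu> - 1/2) (fst r) (snd r) (x, t))"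
proof -
  define R where "R t = t\<^sup>2 - \<rho>\<^sup>2" for t
  define C0 where "C0 r t = c r * R t ^ snd r" for r :: "('n \<Rightarrow> nat) \<times> nat" and t
  define C1 where "C1 r t = c r * (real (snd r) * (R t ^ (snd r - 1) * (2 * t)))" for r :: "('n \<Rightarrow> nat) \<times> nat" and t
  define C2 where "C2 r t = c r * (real (snd r) * (real (snd r - 1) * (R t ^ (snd r - 1 - 1) * (2 * t)) * (2 * t)
      + R t ^ (snd r - 1) * 2))" for r :: "('n \<Rightarrow> nat) \<times> nat" and t
  have R: "(R has_real_derivative 2 * t) (at t)" for t
    unfolding R_def by (auto intro!: derivative_eq_intros)
  have d0: "(C0 r has_real_derivative C1 r t) (at t)" for r t
    unfolding C0_def C1_def by (auto intro!: derivative_eq_intros R simp: mult_ac)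
  have d1: "(C1 r has_real_derivative C2 r t) (at t)" for r t
    unfolding C1_def C2_def by (auto intro!: derivative_eq_intros R simp: algebra_simps)
  let ?N = "\<lambda>r :: ('n \<Rightarrow> nat) \<times> nat. real (\<Sum>i\<in>UNIV. fst r i)"
  let ?X = "\<lambda>r :: ('n \<Rightarrow> nat) \<times> nat. xmono (fst r) x"
  let ?L = "\<lambda>r :: ('n \<Rightarrow> nat) \<times> nat. \<Sum>i\<in>UNIV. real (fst r i) * (real (fst r i) - 1) * xmono ((fst r)(i := fst r i - 2)) x"
  have u: "u = (\<lambda>z. \<Sum>r\<in>I. C0 r (snd z) * xmono (fst r) (fst z))"
    unfolding u C0_def R_def hmono_def by (simp add: mult_ac)
  have pt: "partial_t u = (\<lambda>z. \<Sum>r\<in>I. C1 r (snd z) * xmono (fst r) (fst z))"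
    unfolding u by (rule partial_t_xmono_sum) (rule d0)
  have ptt: "partial_t (partial_t u) = (\<lambda>z. \<Sum>r\<in>I. C2 r (snd z) * xmono (fst r) (fst z))"
    unfolding pt by (rule partial_t_xmono_sum) (rule d1)
  have eu: "euler_x u = (\<lambda>z. \<Sum>r\<in>I. (?N r * C0 r (snd z)) * xmono (fst r) (fst z))"
    unfolding u by (rule euler_x_xmono_sum)
  have eeu: "euler_x (euler_x u) = (\<lambda>z. \<Sum>r\<in>I. (?N r * (?N r * C0 r (snd z))) * xmono (fst r) (fst z))"
    unfolding eu by (rule euler_x_xmono_sum[where c="\<lambda>r t. ?N r * C0 r t"])
  have ept: "euler_x (partial_t u) = (\<lambda>z. \<Sum>r\<in>I. (?N r * C1 r (snd z)) * xmono (fst r) (fst z))"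
    unfolding pt by (rule euler_x_xmono_sum)
  have lap: "laplace_x u (x, t) = (\<Sum>r\<in>I. C0 r t * ?L r)"
    unfolding u by (subst laplace_x_xmono_sum) simp
  let ?d = "real CARD('n)"
  define E where "E = 2 * \<mu> + ?d"
  define G where "G = 2 * \<gamma> + E + 1"
  have 1: "1 + \<rho>\<^sup>2 - t\<^sup>2 = 1 - R t" "\<rho>\<^sup>2 / t\<^sup>2 = 1 - R t / t\<^sup>2"
    using t by (auto simp: R_def diff_divide_distrib)
  have "(1 - R t) * (R t / t\<^sup>2) * (C2 r t * ?X r) + C0 r t * ?L r - ?N r * (?N r * C0 r t) * ?X r + ?N r * C0 r t * ?X r
      + 2 / t * (1 - R t) * (?N r * C1 r t * ?X r)
      + ((1 - R t) * (1 - R t / t\<^sup>2) + E) * (1 / t) * (C1 r t * ?X r)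
      - G * (R t / t\<^sup>2 * t * (C1 r t * ?X r) + ?N r * C0 r t * ?X r)
    = c r * hyp_op \<rho> (\<gamma> - 1/2) (\<mu> - 1/2) (fst r) (snd r) (x, t)" for r :: "('n \<Rightarrow> nat) \<times> nat"
  proof -
    define k where "k = snd r"
    define A where "A = ?N r"
    define X where "X = ?X r"
    define L where "L = ?L r"
    define c1 where "c1 = real k * (R t ^ (k - 1) * (2 * t))"
    define c2 where "c2 = real k * (real (k - 1) * (R t ^ (k - 1 - 1) * (2 * t)) * (2 * t) + R t ^ (k - 1) * 2)"
    note rad = radial_part[OF t, of "R t" k A E G, folded c1_def c2_def]
    have "c r * hyp_op \<rho> (\<gamma> - 1/2) (\<mu> - 1/2) (fst r) (snd r) (x, t) =
        c r * (R t ^ k * L + (2 * real k * (2 * real k + 2 * A + (E - 1)) * R t ^ (k - 1)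
          - (A + 2 * real k) * (A + 2 * real k + G - 1) * R t ^ k) * X)"
    proof -
      have "(\<Sum>i\<in>UNIV. real (fst r i) * (real (fst r i) - 1) * hmono \<rho> ((fst r)(i := fst r i - 2)) k (x, t)) = R t ^ k * L"
        by (simp add: hmono_def L_def R_def sum_distrib_left mult_ac)
      moreover have "hmono \<rho> (fst r) j (x, t) = R t ^ j * X" for j
        by (simp add: hmono_def X_def R_def)
      \<comment> \<open>The half shifts in the exponents amount to d + 2q = E - 1 and 2p + 2q + 2 +
        d = G - 1.\<close>
      moreover have "2 * real k + 2 * A + ?d + 2 * (\<mu> - 1/2) = 2 * real k + 2 * A + (E - 1)"
        "A + 2 * real k + 2 * (\<gamma> - 1/2) + 2 * (\<mu> - 1/2) + 2 + ?d = A + 2 * real k + G - 1"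
        by (simp_all add: E_def G_def)
      ultimately show ?thesis
        unfolding hyp_op_def k_def[symmetric] A_def[symmetric] by (simp only: left_diff_distrib mult.assoc add_diff_eq)
    qed
    \<comment> \<open>The pure Euler terms contribute -A^2 + A - G A = -A (A - 1 + G), exactly the
      amount by which the radial identity falls short of the diagonal coefficient.\<close>
    also have "\<dots> = c r * (R t ^ k * L + ((1 - R t) * (R t / t\<^sup>2) * c2 + 2 / t * (1 - R t) * (A * c1)
        + ((1 - R t) * (1 - R t / t\<^sup>2) + E) * (1 / t) * c1 - G * (R t / t\<^sup>2 * t * c1)
        - A * (A - 1 + G) * R t ^ k) * X)"
      unfolding rad by (simp only: left_diff_distrib diff_diff_eq2 diff_add_cancel) (simp add: algebra_simps)
    finally show ?thesis
      unfolding C0_def C1_def C2_def k_def[symmetric] c1_def[symmetric] c2_def[symmetric]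
        A_def[symmetric] X_def[symmetric] L_def[symmetric]
      by (simp add: algebra_simps)
  qed
  then have "(\<Sum>r\<in>I. c r * hyp_op \<rho> (\<gamma> - 1/2) (\<mu> - 1/2) (fst r) (snd r) (x, t)) =
    (\<Sum>r\<in>I. (1 - R t) * (R t / t\<^sup>2) * (C2 r t * ?X r) + C0 r t * ?L r - ?N r * (?N r * C0 r t) * ?X r + ?N r * C0 r t * ?X r
      + 2 / t * (1 - R t) * (?N r * C1 r t * ?X r)
      + ((1 - R t) * (1 - R t / t\<^sup>2) + E) * (1 / t) * (C1 r t * ?X r)
      - G * (R t / t\<^sup>2 * t * (C1 r t * ?X r) + ?N r * C0 r t * ?X r))"
    by simp
  then show ?thesis
    unfolding 1 add.assoc[of _ "2 * \<mu>" ?d] E_def[symmetric] G_def[symmetric] diff_diff_eq2 add_diff_cancel_left'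
    unfolding ptt eeu ept lap unfolding eu unfolding pt fst_conv snd_conv
    by (simp only: sum.distrib sum_subtractf sum_distrib_left distrib_left)
qed

subsection \<open>Eigenfunctions\<close>

text \<open>The lowered terms lose two degrees. The monomial itself, of degree N, is multiplied by
  the difference of the eigenvalues at m + 1 and at N: this is zero for N = m + 1, and for N <= m
  the monomial already lies in the target.\<close>

lemma hyp_op_plus_eigenvalue_in_hspan:
  fixes \<alpha> :: "'n::finite \<Rightarrow> nat"
  assumes "(\<alpha>, k) \<in> even_index (Suc m)"
  shows "(\<lambda>z. hyp_op \<rho> p q \<alpha> k z
    + real (Suc m) * (real (Suc m) + 2 * p + 2 * q + 2 + real CARD('n)) * hmono \<rho> \<alpha> k z) \<in> hspan \<rho> m"
proof -
  let ?N = "real (\<Sum>i\<in>UNIV. \<alpha> i) + 2 * real k"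
  let ?l = "\<lambda>N. N * (N + 2 * p + 2 * q + 2 + real CARD('n))"
  let ?b = "2 * real k * (2 * real k + 2 * real (\<Sum>i\<in>UNIV. \<alpha> i) + real CARD('n) + 2 * q)"
  have le: "(\<Sum>i\<in>UNIV. \<alpha> i) + 2 * k \<le> Suc m"
    using assms by (simp add: even_index_def)
  have x: "(\<lambda>z. real (\<alpha> i) * (real (\<alpha> i) - 1) * hmono \<rho> (\<alpha>(i := \<alpha> i - 2)) k z) \<in> hspan \<rho> m" for i
  proof (cases "\<alpha> i \<ge> 2")
    case True
    have "(\<Sum>j\<in>UNIV. \<alpha> j) = \<alpha> i + (\<Sum>j\<in>UNIV - {i}. \<alpha> j)"
      by (simp add: sum.remove)
    moreover have "(\<Sum>j\<in>UNIV. (\<alpha>(i := \<alpha> i - 2)) j) = \<alpha> i - 2 + (\<Sum>j\<in>UNIV - {i}. \<alpha> j)"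
      by (subst sum.remove[of _ i]) (auto intro: sum.cong)
    ultimately have "(\<Sum>j\<in>UNIV. (\<alpha>(i := \<alpha> i - 2)) j) + 2 * k \<le> m"
      using True le by linarith
    then show ?thesis
      by (intro fspan_cmult hmono_in_hspan)
  next
    case False
    then have "real (\<alpha> i) * (real (\<alpha> i) - 1) = 0"
      by (auto simp: numeral_2_eq_2 not_le less_Suc_eq)
    then show ?thesis
      by (simp only: mult_zero_left fspan_0)
  qed
  have r: "(\<lambda>z. ?b * hmono \<rho> \<alpha> (k - 1) z) \<in> hspan \<rho> m"
  proof (cases k)
    case 0
    then show ?thesis by (simp add: fspan_0)
  next
    case (Suc j)
    then show ?thesis
      using le by (intro fspan_cmult hmono_in_hspan) simp
  qed
  have l: "(\<lambda>z. (?l (real (Suc m)) - ?l ?N) * hmono \<rho> \<alpha> k z) \<in> hspan \<rho> m"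
  proof (cases "(\<Sum>i\<in>UNIV. \<alpha> i) + 2 * k = Suc m")
    case True
    then have "?N = real (Suc m)"
      by (metis of_nat_add of_nat_mult of_nat_numeral)
    then show ?thesis
      by (simp only: diff_self mult_zero_left fspan_0)
  next
    case False
    then show ?thesis
      using le by (intro fspan_cmult hmono_in_hspan) simp
  qed
  have "(\<lambda>z. hyp_op \<rho> p q \<alpha> k z + ?l (real (Suc m)) * hmono \<rho> \<alpha> k z) =
      (\<lambda>z. (\<Sum>i\<in>UNIV. real (\<alpha> i) * (real (\<alpha> i) - 1) * hmono \<rho> (\<alpha>(i := \<alpha> i - 2)) k z)
        + ?b * hmono \<rho> \<alpha> (k - 1) z + (?l (real (Suc m)) - ?l ?N) * hmono \<rho> \<alpha> k z)"
    unfolding hyp_op_def left_diff_distrib[of "?l (real (Suc m))"] by (intro ext) linarith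
  also have "\<dots> \<in> hspan \<rho> m"
    by (intro fspan_add fspan_sum x r l)
  finally show ?thesis .
qed

text \<open>Replacing L by its polynomial action on coefficients makes the equation available at
  every point, including t = 0. Orthogonality enters through \<open>K s\<close>, the image of a
  monomial under L plus the eigenvalue: it has degree below n for every s in
  \<open>even_index n\<close>.\<close>

lemma hyp_op_eigenfunction:
  fixes c :: "('n::finite \<Rightarrow> nat) \<times> nat \<Rightarrow> real"
  assumes p: "-1 < p" and q: "-1 < q"
    and u: "u = (\<lambda>z. \<Sum>r\<in>even_index n. c r * hmono \<rho> (fst r) (snd r) z)"
    and orth: "\<And>m g. m < n \<Longrightarrow> g \<in> hspan \<rho> m \<Longrightarrow> hyp_integral \<rho> p q (\<lambda>z. u z * g z) = 0"
  shows "(\<Sum>r\<in>even_index n. c r * hyp_op \<rho> p q (fst r) (snd r) z)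
    = - (real n * (real n + 2 * p + 2 * q + 2 + real CARD('n))) * u z"
proof (cases n)
  case 0
  \<comment> \<open>There is no degree below 0 to map into; instead constants are annihilated
    directly.\<close>
  have "fst r = (\<lambda>_. 0) \<and> snd r = 0" if "r \<in> even_index 0" for r :: "('n \<Rightarrow> nat) \<times> nat"
    using that by (auto simp: even_index_def)
  then show ?thesis
    unfolding 0 by (auto simp: hyp_op_def intro!: sum.neutral)
next
  case (Suc m)
  define l where "l = real n * (real n + 2 * p + 2 * q + 2 + real CARD('n))"
  define K where "K r z = hyp_op \<rho> p q (fst r) (snd r) z + l * hmono \<rho> (fst r) (snd r) z" for r :: "('n \<Rightarrow> nat) \<times> nat" and z
  define w where "w z = (\<Sum>r\<in>even_index n. c r * K r z)" for z
  have K: "K r \<in> hspan \<rho> m" if "r \<in> even_index n" for r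
    using hyp_op_plus_eigenvalue_in_hspan[of "fst r" "snd r" m \<rho> p q] that unfolding K_def l_def Suc by simp
  have sub: "even_index m \<subseteq> even_index n"
    by (auto simp: even_index_def Suc)
  have Kpoly: "real_polynomial_function (K r)" if "r \<in> even_index n" for r
    using K[OF that] by (rule real_polynomial_function_hspan)
  have Hpoly: "real_polynomial_function (hyp_op \<rho> p q \<alpha> k)" for \<alpha> :: "'n \<Rightarrow> nat" and k
    unfolding hyp_op_def by (intro rpf_intros real_polynomial_function_hmono)
  have "w \<in> hspan \<rho> m"
    unfolding w_def by (intro fspan_sum fspan_cmult) (rule K)
  then obtain d where d: "w = (\<lambda>z. \<Sum>s\<in>even_index m. d s * hmono \<rho> (fst s) (snd s) z)"
    unfolding fspan_def by blast
  note lin = hyp_integral_add[OF _ _ p q] hyp_integral_sum[OF _ p q] hyp_integral_cmult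
  have sym: "hyp_integral \<rho> p q (\<lambda>z. K r z * hmono \<rho> (fst s) (snd s) z) = hyp_integral \<rho> p q (\<lambda>z. hmono \<rho> (fst r) (snd r) z * K s z)" for r s
  proof -
    have "hyp_integral \<rho> p q (\<lambda>z. K r z * hmono \<rho> (fst s) (snd s) z) =
        hyp_integral \<rho> p q (\<lambda>z. hyp_op \<rho> p q (fst r) (snd r) z * hmono \<rho> (fst s) (snd s) z)
        + l * hyp_integral \<rho> p q (\<lambda>z. hmono \<rho> (fst r) (snd r) z * hmono \<rho> (fst s) (snd s) z)"
      unfolding K_def distrib_right mult.assoc
      by (subst lin) (auto intro!: rpf_intros Hpoly simp: lin(3))
    also have "\<dots> = hyp_integral \<rho> p q (\<lambda>z. hmono \<rho> (fst r) (snd r) z * hyp_op \<rho> p q (fst s) (snd s) z)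
        + l * hyp_integral \<rho> p q (\<lambda>z. hmono \<rho> (fst r) (snd r) z * hmono \<rho> (fst s) (snd s) z)"
      by (simp only: hyp_op_symmetric[OF p q])
    also have "\<dots> = hyp_integral \<rho> p q (\<lambda>z. hmono \<rho> (fst r) (snd r) z * K s z)"
      unfolding K_def distrib_left mult.left_commute[of _ l]
      by (subst lin) (auto intro!: rpf_intros Hpoly simp: lin(3))
    finally show ?thesis .
  qed
  \<comment> \<open>Only one factor is expanded in monomials of degree at most m. The other keeps
    its form as an image of \<open>u\<close>, so symmetry moves the operator from \<open>u\<close>
    to those monomials.\<close>
  have "hyp_integral \<rho> p q (\<lambda>z. w z * w z) =
      hyp_integral \<rho> p q (\<lambda>z. \<Sum>s\<in>even_index m. d s * (\<Sum>r\<in>even_index n. c r * (K r z * hmono \<rho> (fst s) (snd s) z)))"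
    by (subst (2) d) (simp add: w_def sum_distrib_left sum_distrib_right mult_ac)
  also have "\<dots> = (\<Sum>s\<in>even_index m. d s * (\<Sum>r\<in>even_index n. c r * hyp_integral \<rho> p q (\<lambda>z. K r z * hmono \<rho> (fst s) (snd s) z)))"
    by (simp add: lin rpf_intros Kpoly finite_even_index)
  also have "\<dots> = (\<Sum>s\<in>even_index m. d s * (\<Sum>r\<in>even_index n. c r * hyp_integral \<rho> p q (\<lambda>z. hmono \<rho> (fst r) (snd r) z * K s z)))"
    unfolding sym ..
  also have "\<dots> = (\<Sum>s\<in>even_index m. d s * hyp_integral \<rho> p q (\<lambda>z. u z * K s z))"
  proof (intro sum.cong refl arg_cong2[of _ _ _ _ "(*)"])
    fix s :: "('n \<Rightarrow> nat) \<times> nat"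
    assume "s \<in> even_index m"
    then have "real_polynomial_function (K s)"
      using Kpoly sub by blast
    then show "(\<Sum>r\<in>even_index n. c r * hyp_integral \<rho> p q (\<lambda>z. hmono \<rho> (fst r) (snd r) z * K s z)) =
        hyp_integral \<rho> p q (\<lambda>z. u z * K s z)"
      unfolding u sum_distrib_right mult.assoc by (simp add: lin rpf_intros)
  qed
  also have "\<dots> = 0"
    using orth[of m] K sub by (intro sum.neutral) (auto simp: Suc)
  finally have "w z = 0"
    using \<open>w \<in> hspan \<rho> m\<close> p q by (intro hyp_integral_square_eq_0D[of w]) (auto intro: real_polynomial_function_hspan)
  then have "(\<Sum>r\<in>even_index n. c r * hyp_op \<rho> p q (fst r) (snd r) z) + l * u z = 0"
    by (simp add: w_def K_def u distrib_left sum.distrib sum_distrib_left mult.left_commute)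
  then show ?thesis
    unfolding l_def[symmetric] by (simp add: eq_neg_iff_add_eq_0)
qed

theorem theorem4p8:
  fixes \<rho> \<gamma> \<mu> :: real and n :: nat
    and u :: "(real ^ 'n::finite) \<times> real \<Rightarrow> real"
    and x :: "real ^ 'n" and t :: real
  assumes "\<rho> \<ge> 0" and "\<gamma> > - 1/2" and "\<mu> > - 1/2"
    and "u \<in> orth_polys_even \<rho> \<gamma> \<mu> n"
    and "t \<noteq> 0"
  shows "(1 + \<rho>\<^sup>2 - t\<^sup>2) * (1 - \<rho>\<^sup>2 / t\<^sup>2) * partial_t (partial_t u) (x, t)
       + laplace_x u (x, t) - euler_x (euler_x u) (x, t) + euler_x u (x, t)
       + 2 / t * (1 + \<rho>\<^sup>2 - t\<^sup>2) * euler_x (partial_t u) (x, t)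
       + ((1 + \<rho>\<^sup>2 - t\<^sup>2) * (\<rho>\<^sup>2 / t\<^sup>2) + 2 * \<mu> + real CARD('n)) * (1 / t) * partial_t u (x, t)
       - (2 * \<gamma> + 2 * \<mu> + real CARD('n) + 1)
           * ((1 - \<rho>\<^sup>2 / t\<^sup>2) * t * partial_t u (x, t) + euler_x u (x, t))
     = - (real n * (real n + 2 * \<gamma> + 2 * \<mu> + real CARD('n))) * u (x, t)"
proof -
  have u: "u \<in> polys_upto n" "\<And>x t. u (x, - t) = u (x, t)"
    and orth: "\<And>m g. m < n \<Longrightarrow> g \<in> polys_upto m \<Longrightarrow> hyp_inner \<rho> \<gamma> \<mu> u g = 0"
    using assms(4) unfolding orth_polys_even_def by blast+
  obtain c where c: "u = (\<lambda>z. \<Sum>r\<in>even_index n. c r * hmono \<rho> (fst r) (snd r) z)"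
    using even_polys_upto_in_hspan[OF u, of \<rho>] unfolding fspan_def by blast
  \<comment> \<open>The two half shifts cancel the summand 2 and leave the eigenvalue n (n +
    2\<gamma> + 2\<mu> + d).\<close>
  have "(\<Sum>r\<in>even_index n. c r * hyp_op \<rho> (\<gamma> - 1/2) (\<mu> - 1/2) (fst r) (snd r) (x, t))
      = - (real n * (real n + 2 * (\<gamma> - 1/2) + 2 * (\<mu> - 1/2) + 2 + real CARD('n))) * u (x, t)"
  proof (rule hyp_op_eigenfunction[OF _ _ c])
    show "- 1 < \<gamma> - 1/2" "- 1 < \<mu> - 1/2"
      using assms(2,3) by simp_all
    fix m and g :: "(real ^ 'n) \<times> real \<Rightarrow> real"
    assume "m < n" "g \<in> hspan \<rho> m"
    then have "hyp_inner \<rho> \<gamma> \<mu> u g = 0"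
      using orth hspan_subset_polys_upto by blast
    then show "hyp_integral \<rho> (\<gamma> - 1/2) (\<mu> - 1/2) (\<lambda>z. u z * g z) = 0"
      using hyp_inner_eq_hint[OF assms(1), of \<gamma> \<mu> u g] by simp
  qed
  then show ?thesis
    unfolding operator_on_hspan[OF c assms(5)] by simp
qed

end
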